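(* Let $P$ be a stationary random field on $\Omega=\Upsilon^{\mathbb Z^2}$ satisfying the strong $0$-$1$ law and condition (B). Fix $\lambda\in[0,1]$ and reals $x<\tilde x$. For $b\in\mathbb R$ and $n\in\mathbb N$ let $$L_n(b)=\big\{(z,\lfloor\lambda z+nb\rfloor):\ z\in\mathbb Z\cap[nx,n\tilde x]\big\},$$ the lattice approximation of the $n$-fold blowup of the segment $\{(s,\lambda s+b):s\in[x,\tilde x]\}$. Then $$\sup_{b\in\mathbb R}\Big\|\frac{1}{|L_n(b)|}\mathcal I\big(P_{L_n(b)}\big)-h_\lambda(P)\Big\|_{L^1(P)}\xrightarrow[n\to\infty]{}0.$$
   Context: $\Upsilon$ finite, $\Omega=\Upsilon^{\mathbb Z^2}$ with product $\sigma$-algebra; $\omega_V$ restriction, $\mathcal F_V=\sigma(\omega_V)$; stationary = shift-invariant. $\mathcal I(P_V)(\omega)=-\log P[\omega_V]$, $P[\omega_V]=P(\{\eta:\eta_V=\omega_V\})$. $P_0[\cdot\mid\mathcal G](\omega)$ conditional law of $\omega_{(0,0)}$ given $\mathcal G$; $H(\mu)=-\sum_y\mu(y)\log\mu(y)$. Strong $0$-$1$ law: for every $J\subseteq\mathbb Z^2$, $\mathcal F_J=\bigcap_{V\text{ finite}}\mathcal F_{J\cup(\mathbb Z^2\setminus V)}$ mod $P$. Condition (B): there is $c_0>0$ with $P(\omega_{(0,0)}=y\mid A)>c_0$ for all $y\in\Upsilon$, $A\in\mathcal F_{\mathbb Z^2\setminus\{(0,0)\}}$ with $P(A)>0$. For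 $\lambda,a\in\mathbb R$ and $U\subseteq\mathbb Z$: $L_{\lambda,a}(U)=\{(z,\lfloor\lambda z+a\rfloor):z\in U\}$. Past $\sigma$-algebra $\mathcal P_{\lambda,t}=\mathcal F_{L_{\lambda,t}(\{-1,-2,\dots\})}$. Specific entropy along slope $\lambda$: $h_\lambda(P)=\int_0^1E_P\big[H(P_0[\cdot\mid\mathcal P_{\lambda,t}])\big]dt$. *)

theory Defs
  imports "HOL-Probability.Probability"
begin

type_synonym site = "int \<times> int"
type_synonym 'a config = "site \<Rightarrow> 'a"

definition config_space :: "'a config measure" where
  "config_space = PiM UNIV (\<lambda>_. count_space UNIV)"

definition FF :: "site set \<Rightarrow> 'a config measure" where
  "FF J = vimage_algebra UNIV (\<lambda>\<omega>. restrict \<omega> J) (PiM J (\<lambda>_. count_space UNIV))"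

definition shift :: "site \<Rightarrow> 'a config \<Rightarrow> 'a config" where
  "shift v \<omega> = (\<lambda>u. \<omega> (u + v))"

definition stationary :: "'a config measure \<Rightarrow> bool" where
  "stationary P \<longleftrightarrow> (\<forall>v. distr P P (shift v) = P)"

text \<open>Strong 0-1 law: F_J equals the intersection over finite V of F_{J union (Z^2 - V)} mod P.
  (The inclusion of F_J into the intersection holds trivially.)\<close>
definition strong_01_law :: "'a config measure \<Rightarrow> bool" where
  "strong_01_law P \<longleftrightarrow>
     (\<forall>J. \<forall>A. (\<forall>V. finite V \<longrightarrow> A \<in> sets (FF (J \<union> (UNIV - V)))) \<longrightarrow>
        (\<exists>B \<in> sets (FF J). A \<in> sets P \<and> B \<in> sets P \<and> measure P ((A - B) \<union> (B - A)) = 0))"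

definition condition_B :: "('a::finite) config measure \<Rightarrow> bool" where
  "condition_B P \<longleftrightarrow> (\<exists>c0>0. \<forall>y. \<forall>A \<in> sets (FF (UNIV - {(0,0)})).
      measure P A > 0 \<longrightarrow> measure P ({\<omega>. \<omega> (0,0) = y} \<inter> A) / measure P A > c0)"

definition cyl_prob :: "'a config measure \<Rightarrow> site set \<Rightarrow> 'a config \<Rightarrow> real" where
  "cyl_prob P V \<omega> = measure P {\<eta>. \<forall>v\<in>V. \<eta> v = \<omega> v}"

definition info :: "'a config measure \<Rightarrow> site set \<Rightarrow> 'a config \<Rightarrow> real" where
  "info P V \<omega> = - ln (cyl_prob P V \<omega>)"

definition cond_law :: "'a config measure \<Rightarrow> 'a config measure \<Rightarrow> 'a config \<Rightarrow> 'a \<Rightarrow> real" where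
  "cond_law P G \<omega> y = real_cond_exp P G (indicator {\<eta>. \<eta> (0,0) = y}) \<omega>"

text \<open>Shannon entropy of a probability vector on a finite alphabet (0 log 0 = 0).\<close>
definition entropy_fin :: "('a::finite \<Rightarrow> real) \<Rightarrow> real" where
  "entropy_fin \<mu> = - (\<Sum>y\<in>UNIV. \<mu> y * ln (\<mu> y))"

definition Lline :: "real \<Rightarrow> real \<Rightarrow> int set \<Rightarrow> site set" where
  "Lline lam a U = {(z, \<lfloor>lam * of_int z + a\<rfloor>) | z. z \<in> U}"

definition past :: "real \<Rightarrow> real \<Rightarrow> 'a config measure" where
  "past lam t = FF (Lline lam t {z. z \<le> -1})"

definition h_slope :: "real \<Rightarrow> ('a::finite) config measure \<Rightarrow> real" where
  "h_slope lam P = (LBINT t:{0..1}. (\<integral>\<omega>. entropy_fin (cond_law P (past lam t) \<omega>) \<partial>P))"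

text \<open>L_n(b): lattice approximation of the n-fold blowup of a segment.\<close>
definition Ln :: "real \<Rightarrow> real \<Rightarrow> real \<Rightarrow> nat \<Rightarrow> real \<Rightarrow> site set" where
  "Ln lam x x' n b = {(z, \<lfloor>lam * of_int z + real n * b\<rfloor>) | z.
       real n * x \<le> of_int z \<and> of_int z \<le> real n * x'}"

end

theory Submission
  imports Defs
begin

text \<open>By the chain rule and stationarity, the information of a line segment is a sum of conditional
  informations at the origin given the finite past of a line through a point \<open>(0, t)\<close>, evaluated
  along shifts; \<open>t\<close> moves along the rotation by the slope. Three facts then give the limit.

  (1) The finite past may be truncated at a fixed depth, uniformly in \<open>t\<close>: the second moment of the
  conditional law is monotone in the conditioning set, and by martingale convergence together with
  the strong 0-1 law it is continuous for local convergence of conditioning sets, so compactness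
  of the unit interval applies.

  (2) The strong 0-1 law for the empty set makes the field mixing, so the average of the truncated
  terms, which take only finitely many forms, concentrates around its mean in \<open>L\<^sup>2\<close>.

  (3) The mean of a truncated term is a step function of \<open>t\<close> whose jumps lie at multiples of the slope
  modulo 1; such functions have bounded discrepancy along the rotation.\<close>

section \<open>Conditional expectations along monotone families\<close>

text \<open>The pasts of parallel lines are not ordered by inclusion, nor do they vary continuously
  with the offset: as the offset rises to \<open>t\<close>, they converge locally to a graph that
  need not be the past of any line of that slope. Monotonicity of an entropy compares nested sets
  only. The way out is a sandwich: a set that agrees with \<open>J\<close> on a large box lies
  between \<open>J \<inter> box m\<close> and \<open>J \<union> - box m\<close>, and a monotone
  functional (\<open>law_sqnorm\<close>) has the same limit along both, the outer one thanks to the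
  strong 0-1 law. Increments of this functional dominate squared L1 distances of conditional laws;
  condition (B) keeps these laws above a constant, where the logarithm is Lipschitz, so the control
  passes to informations.

  The conditioning set changes from site to site, so the summands need not form a stationary
  sequence, and the bound must be uniform in the offset. The averaging is therefore quantitative:
  covariances are bounded for the finitely many patterns in one box, and the discrepancy bound
  depends neither on the starting point nor on the number of terms.\<close>

lemma L1_Cauchy_AE_convergent_subseq:
  fixes u :: "nat \<Rightarrow> 'a \<Rightarrow> real"
  assumes int: "\<And>n. integrable M (u n)"
    and cauchy: "\<And>e. e > 0 \<Longrightarrow> \<exists>N. \<forall>m\<ge>N. \<forall>n\<ge>N. (\<integral>x. \<bar>u m x - u n x\<bar> \<partial>M) < e"
  shows "\<exists>r::nat\<Rightarrow>nat. strict_mono r \<and> (AE x in M. convergent (\<lambda>i. u (r i) x))"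
proof -
  have "\<forall>i. \<exists>N. \<forall>m\<ge>N. \<forall>n\<ge>N. (\<integral>x. \<bar>u m x - u n x\<bar> \<partial>M) < (1/2::real) ^ i"
    using cauchy by simp
  then obtain N where N: "\<And>i m n. m \<ge> N i \<Longrightarrow> n \<ge> N i \<Longrightarrow> (\<integral>x. \<bar>u m x - u n x\<bar> \<partial>M) < (1/2::real) ^ i"
    by metis
  define r where "r = rec_nat (N 0) (\<lambda>i k. max (N (Suc i)) (Suc k))"
  have r0: "r 0 = N 0" and rS: "\<And>i. r (Suc i) = max (N (Suc i)) (Suc (r i))"
    by (auto simp: r_def)
  have mono: "strict_mono r" unfolding strict_mono_Suc_iff by (simp add: rS less_max_iff_disj)
  have rN: "r i \<ge> N i" for i by (cases i) (auto simp: r0 rS)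
  have step: "(\<integral>x. \<bar>u (r (Suc i)) x - u (r i) x\<bar> \<partial>M) < (1/2) ^ i" for i
    using N[of i "r (Suc i)" "r i"] rN[of i] strict_mono_less[OF mono, of i "Suc i"] by linarith
  have [measurable]: "u n \<in> borel_measurable M" for n using int by auto
  have "(\<integral>\<^sup>+x. (\<Sum>i. ennreal \<bar>u (r (Suc i)) x - u (r i) x\<bar>) \<partial>M)
      = (\<Sum>i. \<integral>\<^sup>+x. ennreal \<bar>u (r (Suc i)) x - u (r i) x\<bar> \<partial>M)"
    by (rule nn_integral_suminf) measurable
  also have "\<dots> = (\<Sum>i. ennreal (\<integral>x. \<bar>u (r (Suc i)) x - u (r i) x\<bar> \<partial>M))"
    by (intro suminf_cong nn_integral_eq_integral) (auto intro!: int integrable_abs Bochner_Integration.integrable_diff)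
  also have "\<dots> \<le> (\<Sum>i. ennreal ((1/2) ^ i))"
    by (intro suminf_le ennreal_leI less_imp_le step) auto
  also have "\<dots> = ennreal (\<Sum>i. (1/2) ^ i)"
    by (intro suminf_ennreal2) (auto intro: summable_geometric)
  finally have "(\<integral>\<^sup>+x. (\<Sum>i. ennreal \<bar>u (r (Suc i)) x - u (r i) x\<bar>) \<partial>M) \<noteq> \<infinity>"
    by (auto simp: top_unique)
  then have "AE x in M. (\<Sum>i. ennreal \<bar>u (r (Suc i)) x - u (r i) x\<bar>) \<noteq> \<infinity>"
    by (intro nn_integral_PInf_AE) measurable
  then have "AE x in M. convergent (\<lambda>i. u (r i) x)"
  proof eventually_elim
    case (elim x)
    then have "summable (\<lambda>i. \<bar>u (r (Suc i)) x - u (r i) x\<bar>)"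
      by (intro summable_suminf_not_top) auto
    then have "summable (\<lambda>i. u (r (Suc i)) x - u (r i) x)"
      by (rule summable_rabs_cancel)
    then have "convergent (\<lambda>n. \<Sum>i<n. u (r (Suc i)) x - u (r i) x)"
      by (simp add: summable_iff_convergent)
    then have "convergent (\<lambda>n. u (r n) x - u (r 0) x)"
      by (simp add: sum_lessThan_telescope[of "\<lambda>i. u (r i) x"])
    then have "convergent (\<lambda>n. (u (r n) x - u (r 0) x) + u (r 0) x)"
      by (intro convergent_add convergent_const)
    then show ?case by simp
  qed
  then show ?thesis using mono by blast
qed

text \<open>Valid for divergent sequences as well, since both sides are the same definite
  description. This makes it usable at every point, without removing a null set.\<close>

lemma lim_offset: "lim (\<lambda>i. f (i + m)) = lim (f :: nat \<Rightarrow> real)"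
proof -
  have "(\<lambda>i. f (i + m)) \<longlonglongrightarrow> L \<longleftrightarrow> f \<longlonglongrightarrow> L" for L
    using LIMSEQ_offset LIMSEQ_ignore_initial_segment by blast
  then show ?thesis by (simp add: lim_def)
qed

context prob_space
begin

lemma subalgebra_sigma_finite: "subalgebra M F \<Longrightarrow> sigma_finite_subalgebra M F"
  by (intro finite_measure_subalgebra_is_sigma_finite finite_measure_subalgebra.intro
      finite_measure_axioms finite_measure_subalgebra_axioms.intro)

lemma L1_le_L2:
  fixes f :: "'a \<Rightarrow> real"
  assumes [measurable]: "f \<in> borel_measurable M" and "integrable M (\<lambda>x. (f x)\<^sup>2)"
  shows "(\<integral>x. \<bar>f x\<bar> \<partial>M) \<le> sqrt (\<integral>x. (f x)\<^sup>2 \<partial>M)"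
proof -
  have i: "integrable M f"
    using assms by (rule square_integrable_imp_integrable)
  have "variance (\<lambda>x. \<bar>f x\<bar>) = (\<integral>x. \<bar>f x\<bar>\<^sup>2 \<partial>M) - (\<integral>x. \<bar>f x\<bar> \<partial>M)\<^sup>2"
    using assms i by (intro variance_eq) auto
  then have "(\<integral>x. \<bar>f x\<bar> \<partial>M)\<^sup>2 \<le> (\<integral>x. (f x)\<^sup>2 \<partial>M)"
    using variance_positive[of "\<lambda>x. \<bar>f x\<bar>"] by simp
  then show ?thesis by (rule real_le_rsqrt)
qed

lemma cond_exp_bounded:
  fixes X :: "'a \<Rightarrow> real"
  assumes F: "subalgebra M F" and X_meas [measurable]: "X \<in> borel_measurable M"
    and X: "\<And>x. \<bar>X x\<bar> \<le> C"
  shows "AE x in M. \<bar>real_cond_exp M F X x\<bar> \<le> C"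
proof -
  interpret sigma_finite_subalgebra M F by (rule subalgebra_sigma_finite[OF F])
  have i: "integrable M X" using X by (intro integrable_const_bound[of _ C]) auto
  have "AE x in M. real_cond_exp M F X x \<ge> -C"
    using X by (intro real_cond_exp_ge_c i AE_I2) (simp add: abs_le_iff minus_le_iff)
  moreover have "AE x in M. real_cond_exp M F X x \<le> C"
    using X by (intro real_cond_exp_le_c i AE_I2) (simp add: abs_le_iff)
  ultimately show ?thesis by eventually_elim auto
qed

lemma integrable_bounded_mult:
  fixes f g :: "'a \<Rightarrow> real"
  assumes "f \<in> borel_measurable M" "g \<in> borel_measurable M"
    and "AE x in M. \<bar>f x\<bar> \<le> C" "AE x in M. \<bar>g x\<bar> \<le> D"
  shows "integrable M (\<lambda>x. f x * g x)"
proof (rule integrable_const_bound[of _ "C * D"])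
  show "AE x in M. norm (f x * g x) \<le> C * D"
    using assms(3,4)
    by eventually_elim (auto simp: abs_mult intro!: mult_mono order_trans[OF abs_ge_zero])
qed (use assms in auto)

text \<open>The projection onto the coarser algebra is orthogonal to the increment: that projection
  is measurable for both algebras, so it may be pulled out of either conditional expectation, and
  its product with the finer one has the same integral as its own square.\<close>

lemma cond_exp_pythagoras:
  fixes X :: "'a \<Rightarrow> real"
  assumes G: "subalgebra M G" and FG: "subalgebra G F"
    and X_meas [measurable]: "X \<in> borel_measurable M"
    and X: "\<And>x. \<bar>X x\<bar> \<le> C"
  shows "(\<integral>x. (real_cond_exp M G X x - real_cond_exp M F X x)\<^sup>2 \<partial>M)
       = (\<integral>x. (real_cond_exp M G X x)\<^sup>2 \<partial>M) - (\<integral>x. (real_cond_exp M F X x)\<^sup>2 \<partial>M)"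
proof -
  have F: "subalgebra M F" using G FG by (auto simp: subalgebra_def)
  interpret F: sigma_finite_subalgebra M F by (rule subalgebra_sigma_finite[OF F])
  interpret G: sigma_finite_subalgebra M G by (rule subalgebra_sigma_finite[OF G])
  let ?f = "real_cond_exp M F X" and ?g = "real_cond_exp M G X"
  have bf: "AE x in M. \<bar>?f x\<bar> \<le> C" and bg: "AE x in M. \<bar>?g x\<bar> \<le> C" and bX: "AE x in M. \<bar>X x\<bar> \<le> C"
    using cond_exp_bounded[OF F X_meas X] cond_exp_bounded[OF G X_meas X] X by auto
  have i: "integrable M (\<lambda>x. ?f x * X x)" "integrable M (\<lambda>x. ?f x * ?f x)"
    "integrable M (\<lambda>x. ?f x * ?g x)" "integrable M (\<lambda>x. ?g x * ?g x)"
    by (rule integrable_bounded_mult[OF _ _ bf bX] integrable_bounded_mult[OF _ _ bf bf]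
        integrable_bounded_mult[OF _ _ bf bg] integrable_bounded_mult[OF _ _ bg bg]; measurable)+
  have "?f \<in> borel_measurable G"
    by (rule measurable_from_subalg[OF FG borel_measurable_cond_exp])
  then have "(\<integral>x. ?f x * ?g x \<partial>M) = (\<integral>x. ?f x * X x \<partial>M)"
    using i by (intro G.real_cond_exp_intg(2)) auto
  also have "\<dots> = (\<integral>x. ?f x * ?f x \<partial>M)"
    using i by (intro F.real_cond_exp_intg(2)[symmetric]) auto
  finally have *: "(\<integral>x. ?f x * ?g x \<partial>M) = (\<integral>x. ?f x * ?f x \<partial>M)" .
  have "(\<integral>x. (?g x - ?f x)\<^sup>2 \<partial>M) = (\<integral>x. ?g x * ?g x - 2 * (?f x * ?g x) + ?f x * ?f x \<partial>M)"
    by (intro Bochner_Integration.integral_cong) (auto simp: power2_eq_square algebra_simps)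
  also have "\<dots> = (\<integral>x. ?g x * ?g x \<partial>M) - 2 * (\<integral>x. ?f x * ?g x \<partial>M) + (\<integral>x. ?f x * ?f x \<partial>M)"
    using i by simp
  finally show ?thesis using * by (simp add: power2_eq_square)
qed

lemma cond_exp_square_mono:
  fixes X :: "'a \<Rightarrow> real"
  assumes "subalgebra M G" and "subalgebra G F" and "X \<in> borel_measurable M" and "\<And>x. \<bar>X x\<bar> \<le> C"
  shows "(\<integral>x. (real_cond_exp M F X x)\<^sup>2 \<partial>M) \<le> (\<integral>x. (real_cond_exp M G X x)\<^sup>2 \<partial>M)"
proof -
  have "0 \<le> (\<integral>x. (real_cond_exp M G X x - real_cond_exp M F X x)\<^sup>2 \<partial>M)" by simp
  then show ?thesis using cond_exp_pythagoras[OF assms] by simp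
qed

lemma integrable_cond_exp_square:
  fixes X :: "'a \<Rightarrow> real"
  assumes F: "subalgebra M F" and X_meas [measurable]: "X \<in> borel_measurable M" and X: "\<And>x. \<bar>X x\<bar> \<le> C"
  shows "integrable M (\<lambda>x. (real_cond_exp M F X x)\<^sup>2)"
  using integrable_bounded_mult[OF _ _ cond_exp_bounded[OF F X_meas X] cond_exp_bounded[OF F X_meas X]]
  by (simp add: power2_eq_square)

lemma cond_exp_L1_dist:
  fixes X :: "'a \<Rightarrow> real"
  assumes G: "subalgebra M G" and FG: "subalgebra G F"
    and X_meas [measurable]: "X \<in> borel_measurable M" and X: "\<And>x. \<bar>X x\<bar> \<le> C"
  shows "(\<integral>x. \<bar>real_cond_exp M G X x - real_cond_exp M F X x\<bar> \<partial>M)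
       \<le> sqrt ((\<integral>x. (real_cond_exp M G X x)\<^sup>2 \<partial>M) - (\<integral>x. (real_cond_exp M F X x)\<^sup>2 \<partial>M))"
proof -
  have F: "subalgebra M F" using G FG by (auto simp: subalgebra_def)
  have b: "AE x in M. \<bar>real_cond_exp M G X x - real_cond_exp M F X x\<bar> \<le> 2 * C"
    using cond_exp_bounded[OF F X_meas X] cond_exp_bounded[OF G X_meas X] by eventually_elim auto
  have "integrable M (\<lambda>x. (real_cond_exp M G X x - real_cond_exp M F X x)\<^sup>2)"
    using integrable_bounded_mult[OF _ _ b b] by (simp add: power2_eq_square)
  from L1_le_L2[OF _ this] show ?thesis
    by (simp add: cond_exp_pythagoras[OF G FG X_meas X])
qed

lemma integrable_cond_exp:
  fixes X :: "'a \<Rightarrow> real"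
  assumes F: "subalgebra M F" and X_meas [measurable]: "X \<in> borel_measurable M" and X: "\<And>x. \<bar>X x\<bar> \<le> C"
  shows "integrable M (real_cond_exp M F X)"
  using cond_exp_bounded[OF F X_meas X] by (intro integrable_const_bound[of _ C]) auto

text \<open>Martingale convergence in both directions: the second moments of the conditional
  expectations are monotone and bounded, and by orthogonality of increments they control the
  \<open>L\<^sup>1\<close>-distances.\<close>

lemma cond_exp_monotone_limit:
  fixes X :: "'a \<Rightarrow> real" and G :: "nat \<Rightarrow> 'a measure"
  assumes sub: "\<And>m. subalgebra M (G m)"
    and mono: "(\<forall>m n. m \<le> n \<longrightarrow> subalgebra (G n) (G m)) \<or> (\<forall>m n. m \<le> n \<longrightarrow> subalgebra (G m) (G n))"
    and X_meas [measurable]: "X \<in> borel_measurable M" and X: "\<And>x. \<bar>X x\<bar> \<le> C"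
  obtains r :: "nat \<Rightarrow> nat" and Y where "strict_mono r"
    "Y = (\<lambda>x. lim (\<lambda>i. real_cond_exp M (G (r i)) X x))"
    "integrable M Y"
    "(\<lambda>m. \<integral>x. \<bar>real_cond_exp M (G m) X x - Y x\<bar> \<partial>M) \<longlonglongrightarrow> 0"
proof -
  let ?W = "\<lambda>m. real_cond_exp M (G m) X"
  define s where "s m = (\<integral>x. (?W m x)\<^sup>2 \<partial>M)" for m
  have C0: "C \<ge> 0" using X[of undefined] by linarith
  have W_bd: "AE x in M. \<bar>?W m x\<bar> \<le> C" for m by (rule cond_exp_bounded[OF sub X_meas X])
  have W_int: "integrable M (?W m)" for m by (rule integrable_cond_exp[OF sub X_meas X])
  have s_bd: "0 \<le> s m" "s m \<le> C\<^sup>2" for m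
  proof -
    show "0 \<le> s m" by (simp add: s_def)
    have "s m \<le> (\<integral>x. C\<^sup>2 \<partial>M)" unfolding s_def
    proof (rule integral_mono_AE)
      show "integrable M (\<lambda>x. (?W m x)\<^sup>2)" by (rule integrable_cond_exp_square[OF sub X_meas X])
      show "AE x in M. (?W m x)\<^sup>2 \<le> C\<^sup>2"
        using W_bd[of m] by eventually_elim (rule power2_le_iff_abs_le[THEN iffD2, OF C0])
    qed simp
    then show "s m \<le> C\<^sup>2" by (simp add: prob_space)
  qed
  have dist: "(\<integral>x. \<bar>?W m x - ?W n x\<bar> \<partial>M) \<le> sqrt \<bar>s m - s n\<bar>" for m n
  proof -
    have *: "(\<integral>x. \<bar>?W m x - ?W n x\<bar> \<partial>M) \<le> sqrt \<bar>s m - s n\<bar>" if "subalgebra (G m) (G n)" for m n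
      using cond_exp_L1_dist[OF sub that X_meas X] real_sqrt_le_mono[OF abs_ge_self[of "s m - s n"]]
      unfolding s_def by linarith
    have "subalgebra (G m) (G n) \<or> subalgebra (G n) (G m)"
      using mono by (meson nle_le)
    then show ?thesis
    proof
      assume "subalgebra (G n) (G m)"
      from *[OF this] show ?thesis by (simp add: abs_minus_commute)
    qed (rule *)
  qed
  have "convergent s"
  proof (rule Bseq_monoseq_convergent)
    show "Bseq s" using s_bd by (intro BseqI'[of _ "C\<^sup>2"]) auto
    have "s m \<le> s n" if "subalgebra (G n) (G m)" for m n
      unfolding s_def by (rule cond_exp_square_mono[OF sub that X_meas X])
    then show "monoseq s" using mono unfolding monoseq_def by blast
  qed
  then have "Cauchy s" by (rule convergent_Cauchy)
  have W_cauchy: "\<exists>N. \<forall>m\<ge>N. \<forall>n\<ge>N. (\<integral>x. \<bar>?W m x - ?W n x\<bar> \<partial>M) < e" if "e > 0" for e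
  proof -
    obtain N where N: "\<forall>m\<ge>N. \<forall>n\<ge>N. norm (s m - s n) < e\<^sup>2"
      using CauchyD[OF \<open>Cauchy s\<close>, of "e\<^sup>2"] \<open>e > 0\<close> by auto
    have "(\<integral>x. \<bar>?W m x - ?W n x\<bar> \<partial>M) < e" if "m \<ge> N" "n \<ge> N" for m n
    proof -
      have "sqrt \<bar>s m - s n\<bar> < e" using N that \<open>e > 0\<close> by (intro real_less_lsqrt) auto
      then show ?thesis using dist[of m n] by linarith
    qed
    then show ?thesis by blast
  qed
  obtain r where r: "strict_mono r" and conv: "AE x in M. convergent (\<lambda>i. ?W (r i) x)"
    using L1_Cauchy_AE_convergent_subseq[of M ?W, OF W_int W_cauchy] by blast
  \<comment> \<open>An explicit pointwise \<open>lim\<close> instead of an abstract L1 limit: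
    \<open>Y\<close> is then measurable for every sigma-algebra for which the terms are, which is
    what the upward and the downward case both need.\<close>
  define Y where "Y = (\<lambda>x. lim (\<lambda>i. ?W (r i) x))"
  have Y_meas [measurable]: "Y \<in> borel_measurable M" unfolding Y_def by measurable
  have all: "AE x in M. \<forall>i. \<bar>?W (r i) x\<bar> \<le> C" using W_bd by (simp add: AE_all_countable)
  have Y_bd: "AE x in M. \<bar>Y x\<bar> \<le> C"
    using conv all
  proof eventually_elim
    case (elim x)
    then have "(\<lambda>i. \<bar>?W (r i) x\<bar>) \<longlonglongrightarrow> \<bar>Y x\<bar>"
      unfolding Y_def by (intro tendsto_rabs) (simp add: convergent_LIMSEQ_iff)
    then show ?case using elim(2) by (intro LIMSEQ_le_const2) auto
  qed
  have Y_int: "integrable M Y" using Y_bd by (intro integrable_const_bound[of _ C]) auto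
  have sub_lim: "(\<lambda>i. \<integral>x. \<bar>?W (r i) x - Y x\<bar> \<partial>M) \<longlonglongrightarrow> (\<integral>x. 0 \<partial>M)"
  proof (rule integral_dominated_convergence[where w = "\<lambda>x. 2 * C"])
    show "AE x in M. (\<lambda>i. \<bar>?W (r i) x - Y x\<bar>) \<longlonglongrightarrow> 0"
      using conv
    proof eventually_elim
      case (elim x)
      then have "(\<lambda>i. ?W (r i) x) \<longlonglongrightarrow> Y x" by (simp add: Y_def convergent_LIMSEQ_iff)
      then show ?case by (simp add: LIM_zero tendsto_rabs_zero)
    qed
    show "AE x in M. norm \<bar>?W (r i) x - Y x\<bar> \<le> 2 * C" for i
      using Y_bd W_bd[of "r i"] by eventually_elim auto
  qed auto
  have lim: "(\<lambda>m. \<integral>x. \<bar>?W m x - Y x\<bar> \<partial>M) \<longlonglongrightarrow> 0"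
  proof (rule LIMSEQ_I)
    fix e :: real assume e: "e > 0"
    obtain N where N: "\<forall>m\<ge>N. \<forall>n\<ge>N. (\<integral>x. \<bar>?W m x - ?W n x\<bar> \<partial>M) < e / 2"
      using W_cauchy[of "e/2"] e by auto
    have "eventually (\<lambda>i. (\<integral>x. \<bar>?W (r i) x - Y x\<bar> \<partial>M) < e / 2) sequentially"
      using sub_lim e by (intro order_tendstoD) auto
    moreover have "eventually (\<lambda>i. i \<ge> N) sequentially" by (rule eventually_ge_at_top)
    ultimately have "eventually (\<lambda>i. (\<integral>x. \<bar>?W (r i) x - Y x\<bar> \<partial>M) < e / 2 \<and> i \<ge> N) sequentially"
      by eventually_elim auto
    then obtain i where i: "(\<integral>x. \<bar>?W (r i) x - Y x\<bar> \<partial>M) < e / 2" "i \<ge> N"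
      using eventually_happens trivial_limit_sequentially by blast
    have ri: "r i \<ge> N" using i(2) seq_suble[OF r, of i] by linarith
    have "norm ((\<integral>x. \<bar>?W m x - Y x\<bar> \<partial>M) - 0) < e" if "m \<ge> N" for m
    proof -
      have "(\<integral>x. \<bar>?W m x - Y x\<bar> \<partial>M) \<le> (\<integral>x. \<bar>?W m x - ?W (r i) x\<bar> + \<bar>?W (r i) x - Y x\<bar> \<partial>M)"
        using W_int Y_int by (intro integral_mono) auto
      also have "\<dots> = (\<integral>x. \<bar>?W m x - ?W (r i) x\<bar> \<partial>M) + (\<integral>x. \<bar>?W (r i) x - Y x\<bar> \<partial>M)"
        using W_int Y_int by (intro Bochner_Integration.integral_add) auto
      also have "\<dots> < e" using N[rule_format, OF that ri] i by linarith
      finally show ?thesis by simp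
    qed
    then show "\<exists>N. \<forall>m\<ge>N. norm ((\<integral>x. \<bar>?W m x - Y x\<bar> \<partial>M) - 0) < e" by blast
  qed
  show ?thesis by (rule that[OF r Y_def Y_int lim])
qed

text \<open>Transfers the defining property of a conditional expectation to an L1 limit. It is asked
  for only eventually, because a set of the \<open>m\<close>-th of increasing algebras can be tested
  only from index \<open>m\<close> on.\<close>

lemma set_integral_L1_limit:
  fixes u :: "nat \<Rightarrow> 'a \<Rightarrow> real"
  assumes u: "\<And>m. integrable M (u m)" and Y: "integrable M Y"
    and lim: "(\<lambda>m. \<integral>x. \<bar>u m x - Y x\<bar> \<partial>M) \<longlonglongrightarrow> 0"
    and A: "A \<in> sets M" and ev: "eventually (\<lambda>m. (\<integral>x\<in>A. u m x \<partial>M) = c) sequentially"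
  shows "(\<integral>x\<in>A. Y x \<partial>M) = c"
proof -
  have "(\<lambda>m. (\<integral>x\<in>A. u m x \<partial>M) - (\<integral>x\<in>A. Y x \<partial>M)) \<longlonglongrightarrow> 0"
  proof (rule Lim_null_comparison[OF always_eventually lim], rule allI)
    fix m
    have i: "set_integrable M A (u m)" "set_integrable M A Y"
      using integrable_mult_indicator[OF A u] integrable_mult_indicator[OF A Y]
      by (simp_all add: set_integrable_def)
    have "norm ((\<integral>x\<in>A. u m x \<partial>M) - (\<integral>x\<in>A. Y x \<partial>M)) = norm (\<integral>x. indicator A x *\<^sub>R (u m x - Y x) \<partial>M)"
      using i unfolding set_integrable_def set_lebesgue_integral_def
      by (subst Bochner_Integration.integral_diff[symmetric]) (auto simp: algebra_simps)
    also have "\<dots> \<le> (\<integral>x. norm (indicator A x *\<^sub>R (u m x - Y x)) \<partial>M)" by (rule integral_norm_bound)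
    also have "\<dots> \<le> (\<integral>x. \<bar>u m x - Y x\<bar> \<partial>M)"
      using u Y A by (intro integral_mono integrable_norm integrable_mult_indicator integrable_abs)
        (auto simp: indicator_def)
    finally show "norm ((\<integral>x\<in>A. u m x \<partial>M) - (\<integral>x\<in>A. Y x \<partial>M)) \<le> (\<integral>x. \<bar>u m x - Y x\<bar> \<partial>M)" .
  qed
  moreover have "(\<lambda>m. (\<integral>x\<in>A. u m x \<partial>M) - (\<integral>x\<in>A. Y x \<partial>M)) \<longlonglongrightarrow> c - (\<integral>x\<in>A. Y x \<partial>M)"
    by (rule tendsto_eventually) (use ev in eventually_elim, simp)
  ultimately show ?thesis using LIMSEQ_unique by fastforce
qed

text \<open>The limit has the integrals of \<open>X\<close> over every set of some
  \<open>G m\<close>. These sets form an intersection-stable generator of \<open>F\<close>, so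
  induction over the generated sigma-algebra identifies the limit as the conditional expectation
  given \<open>F\<close>.\<close>

lemma cond_exp_upward:
  fixes X :: "'a \<Rightarrow> real" and G :: "nat \<Rightarrow> 'a measure"
  assumes F: "subalgebra M F" and FG: "\<And>m. subalgebra F (G m)"
    and inc: "\<And>m n. m \<le> n \<Longrightarrow> subalgebra (G n) (G m)"
    and gen: "sets F = sigma_sets (space M) (\<Union>m. sets (G m))"
    and X_meas [measurable]: "X \<in> borel_measurable M" and X: "\<And>x. \<bar>X x\<bar> \<le> C"
  shows "(\<lambda>m. \<integral>x. \<bar>real_cond_exp M (G m) X x - real_cond_exp M F X x\<bar> \<partial>M) \<longlonglongrightarrow> 0"
proof -
  have sub: "subalgebra M (G m)" for m using F FG[of m] unfolding subalgebra_def by auto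
  interpret F: sigma_finite_subalgebra M F by (rule subalgebra_sigma_finite[OF F])
  obtain r Y where r: "strict_mono r"
    and Y_def: "Y = (\<lambda>x. lim (\<lambda>i. real_cond_exp M (G (r i)) X x))"
    and Y_int: "integrable M Y"
    and lim: "(\<lambda>m. \<integral>x. \<bar>real_cond_exp M (G m) X x - Y x\<bar> \<partial>M) \<longlonglongrightarrow> 0"
    using cond_exp_monotone_limit[of G X C] sub inc X by auto
  have [measurable]: "real_cond_exp M (G m) X \<in> borel_measurable F" for m
    by (rule measurable_from_subalg[OF FG borel_measurable_cond_exp])
  have Y_meas: "Y \<in> borel_measurable F" unfolding Y_def by measurable
  have X_int: "integrable M X" using X by (intro integrable_const_bound[of _ C]) auto
  have W_int: "integrable M (real_cond_exp M (G m) X)" for m by (rule integrable_cond_exp[OF sub X_meas X])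
  have si: "set_integrable M A f" if "A \<in> sets M" "integrable M f" for A and f :: "'a \<Rightarrow> real"
    using integrable_mult_indicator[OF that] by (simp add: set_integrable_def)
  have on_G: "(\<integral>x\<in>A. Y x \<partial>M) = (\<integral>x\<in>A. X x \<partial>M)" if A: "A \<in> sets (G m)" for A m
  proof (rule set_integral_L1_limit[OF W_int Y_int lim])
    show "A \<in> sets M" using A sub by (auto simp: subalgebra_def)
    show "eventually (\<lambda>k. (\<integral>x\<in>A. real_cond_exp M (G k) X x \<partial>M) = (\<integral>x\<in>A. X x \<partial>M)) sequentially"
      using eventually_ge_at_top[of m]
    proof eventually_elim
      case (elim k)
      interpret Gk: sigma_finite_subalgebra M "G k" by (rule subalgebra_sigma_finite[OF sub])
      have "A \<in> sets (G k)" using inc[OF elim] A by (auto simp: subalgebra_def)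
      then show ?case using Gk.real_cond_exp_intA[OF X_int] by simp
    qed
  qed
  have "AE x in M. real_cond_exp M F X x = Y x"
  proof (rule F.real_cond_exp_charact[OF _ X_int Y_int Y_meas])
    fix A assume "A \<in> sets F"
    then have A: "A \<in> sigma_sets (space M) (\<Union>m. sets (G m))" by (simp add: gen)
    have sM: "B \<in> sets M" if "B \<in> sigma_sets (space M) (\<Union>m. sets (G m))" for B
      using that F by (auto simp: gen[symmetric] subalgebra_def)
    have I: "Int_stable (\<Union>m. sets (G m))"
    proof (rule Int_stableI)
      fix a b assume "a \<in> (\<Union>m. sets (G m))" "b \<in> (\<Union>m. sets (G m))"
      then obtain m n where "a \<in> sets (G m)" "b \<in> sets (G n)" by auto
      then have "a \<in> sets (G (max m n))" "b \<in> sets (G (max m n))"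
        using inc[of m "max m n"] inc[of n "max m n"] by (auto simp: subalgebra_def)
      then show "a \<inter> b \<in> (\<Union>m. sets (G m))" by blast
    qed
    have P: "(\<Union>m. sets (G m)) \<subseteq> Pow (space M)"
      using sub sets.space_closed by (fastforce simp: subalgebra_def)
    from I P A show "(\<integral>x\<in>A. X x \<partial>M) = (\<integral>x\<in>A. Y x \<partial>M)"
    proof (induct rule: sigma_sets_induct_disjoint)
      case (basic A)
      then show ?case using on_G by auto
    next
      case empty then show ?case by (simp add: set_lebesgue_integral_def)
    next
      case (compl A)
      have tot: "(\<integral>x\<in>space M. Y x \<partial>M) = (\<integral>x\<in>space M. X x \<partial>M)"
        using on_G[of "space M" 0] sub[of 0] sets.top[of "G 0"] by (simp add: subalgebra_def)
      have split: "(\<integral>x\<in>space M - A. f x \<partial>M) = (\<integral>x\<in>space M. f x \<partial>M) - (\<integral>x\<in>A. f x \<partial>M)"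
        if "integrable M f" for f :: "'a \<Rightarrow> real"
      proof -
        have "(\<integral>x\<in>(space M - A) \<union> A. f x \<partial>M) = (\<integral>x\<in>space M - A. f x \<partial>M) + (\<integral>x\<in>A. f x \<partial>M)"
          using sM[OF compl(1)] that by (intro set_integral_Un si) auto
        moreover have "(space M - A) \<union> A = space M"
          using sets.sets_into_space[OF sM[OF compl(1)]] by blast
        ultimately show ?thesis by simp
      qed
      show ?case using compl(2) tot split[OF X_int] split[OF Y_int] by simp
    next
      case (union A)
      have m: "A i \<in> sets M" for i using sM union(2) by blast
      have d: "A i \<inter> A j = {}" if "i \<noteq> j" for i j
        using union(1) that by (auto simp: disjoint_family_on_def)
      have "(\<integral>x\<in>(\<Union>i. A i). f x \<partial>M) = (\<Sum>i. \<integral>x\<in>A i. f x \<partial>M)" if "integrable M f" for f :: "'a \<Rightarrow> real"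
        using m d that by (intro lebesgue_integral_countable_add si) auto
      then show ?case using X_int Y_int union(3) by simp
    qed
  qed
  then have "(\<integral>x. \<bar>real_cond_exp M (G m) X x - real_cond_exp M F X x\<bar> \<partial>M)
    = (\<integral>x. \<bar>real_cond_exp M (G m) X x - Y x\<bar> \<partial>M)" for m
    by (intro integral_cong_AE) (use Y_int in auto)
  then show ?thesis using lim by simp
qed

text \<open>The limit is the conditional expectation given the intersection \<open>T\<close> of the
  algebras. By \<open>tail\<close> each set of \<open>T\<close> is a set of \<open>F\<close> up to a
  null set, so the conditional expectation given \<open>F\<close> also has the right integrals over
  \<open>T\<close> and is a version of the same function.\<close>

lemma cond_exp_downward:
  fixes X :: "'a \<Rightarrow> real" and G :: "nat \<Rightarrow> 'a measure"
  assumes F: "subalgebra M F" and GF: "\<And>m. subalgebra (G m) F"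
    and sub: "\<And>m. subalgebra M (G m)"
    and dec: "\<And>m n. m \<le> n \<Longrightarrow> subalgebra (G m) (G n)"
    and tail: "\<And>A. (\<And>m. A \<in> sets (G m)) \<Longrightarrow> \<exists>B\<in>sets F. measure M ((A - B) \<union> (B - A)) = 0"
    and X_meas [measurable]: "X \<in> borel_measurable M" and X: "\<And>x. \<bar>X x\<bar> \<le> C"
  shows "(\<lambda>m. \<integral>x. \<bar>real_cond_exp M (G m) X x - real_cond_exp M F X x\<bar> \<partial>M) \<longlonglongrightarrow> 0"
proof -
  interpret F: sigma_finite_subalgebra M F by (rule subalgebra_sigma_finite[OF F])
  obtain r Y where r: "strict_mono r"
    and Y_def: "Y = (\<lambda>x. lim (\<lambda>i. real_cond_exp M (G (r i)) X x))"
    and Y_int: "integrable M Y"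
    and lim: "(\<lambda>m. \<integral>x. \<bar>real_cond_exp M (G m) X x - Y x\<bar> \<partial>M) \<longlonglongrightarrow> 0"
    using cond_exp_monotone_limit[of G X C] sub dec X by auto
  have X_int: "integrable M X" using X by (intro integrable_const_bound[of _ C]) auto
  have W_int: "integrable M (real_cond_exp M (G m) X)" for m by (rule integrable_cond_exp[OF sub X_meas X])
  have F_int: "integrable M (real_cond_exp M F X)" by (rule integrable_cond_exp[OF F X_meas X])
  \<comment> \<open>Dropping the first \<open>m\<close> terms does not change \<open>lim\<close>,
    and \<open>r (i + m) \<ge> m\<close> makes all remaining terms measurable for
    \<open>G m\<close>.\<close>
  have Y_meas: "Y \<in> borel_measurable (G m)" for m
  proof -
    have [measurable]: "real_cond_exp M (G (r (i + m))) X \<in> borel_measurable (G m)" for i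
      using seq_suble[OF r, of "i + m"] by (intro measurable_from_subalg[OF dec borel_measurable_cond_exp]) simp
    have "Y = (\<lambda>x. lim (\<lambda>i. real_cond_exp M (G (r (i + m))) X x))"
      unfolding Y_def by (subst lim_offset[of "\<lambda>i. real_cond_exp M (G (r i)) X _" m]) simp
    then show ?thesis by simp
  qed
  define T where "T = sigma (space M) (\<Inter>m. sets (G m))"
  have TP: "(\<Inter>m. sets (G m)) \<subseteq> Pow (space M)"
    using sub[of 0] sets.space_closed[of "G 0"] by (auto simp: subalgebra_def)
  have "sigma_sets (space M) (\<Inter>m. sets (G m)) \<subseteq> sets (G m)" for m
    using sub[of m] sets.sigma_sets_subset[of "\<Inter>m. sets (G m)" "G m"] by (auto simp: subalgebra_def)
  then have T_sets: "sets T = (\<Inter>m. sets (G m))"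
    unfolding T_def sets_measure_of[OF TP] by (auto intro: sigma_sets.Basic)
  have T_space: "space T = space M" unfolding T_def by (rule space_measure_of[OF TP])
  have T: "subalgebra M T" using sub[of 0] by (auto simp: subalgebra_def T_sets T_space)
  interpret T: sigma_finite_subalgebra M T by (rule subalgebra_sigma_finite[OF T])
  have TF: "subalgebra T F" using GF F by (auto simp: subalgebra_def T_sets T_space)
  have T1: "AE x in M. real_cond_exp M T X x = Y x"
  proof (rule T.real_cond_exp_charact[OF _ X_int Y_int])
    fix A assume A: "A \<in> sets T"
    have "(\<integral>x\<in>A. Y x \<partial>M) = (\<integral>x\<in>A. X x \<partial>M)"
    proof (rule set_integral_L1_limit[OF W_int Y_int lim])
      show "A \<in> sets M" using A T by (auto simp: subalgebra_def)
      show "eventually (\<lambda>k. (\<integral>x\<in>A. real_cond_exp M (G k) X x \<partial>M) = (\<integral>x\<in>A. X x \<partial>M)) sequentially"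
      proof (rule always_eventually, rule allI)
        fix k
        interpret Gk: sigma_finite_subalgebra M "G k" by (rule subalgebra_sigma_finite[OF sub])
        show "(\<integral>x\<in>A. real_cond_exp M (G k) X x \<partial>M) = (\<integral>x\<in>A. X x \<partial>M)"
          using Gk.real_cond_exp_intA[OF X_int] A by (simp add: T_sets)
      qed
    qed
    then show "(\<integral>x\<in>A. X x \<partial>M) = (\<integral>x\<in>A. Y x \<partial>M)" by simp
  next
    have sp: "space T = space (G 0)" using sub[of 0] by (simp add: T_space subalgebra_def)
    show "Y \<in> borel_measurable T"
    proof (rule measurableI)
      fix B :: "real set" assume "B \<in> sets borel"
      then have "Y -` B \<inter> space T \<in> sets (G m)" for m
        using measurable_sets[OF Y_meas[of m]] sub[of m] by (simp add: subalgebra_def T_space)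
      then show "Y -` B \<inter> space T \<in> sets T" by (simp add: T_sets)
    qed simp
  qed
  have T2: "AE x in M. real_cond_exp M T X x = real_cond_exp M F X x"
  proof (rule T.real_cond_exp_charact[OF _ X_int F_int])
    fix A assume A: "A \<in> sets T"
    then obtain B where B: "B \<in> sets F" "measure M ((A - B) \<union> (B - A)) = 0"
      using tail[of A] by (auto simp: T_sets)
    have AB: "A \<in> sets M" "B \<in> sets M" using A B T F by (auto simp: subalgebra_def)
    have "(A - B) \<union> (B - A) \<in> null_sets M"
      using B AB by (auto simp: emeasure_eq_measure null_sets_def)
    then have ae: "AE x in M. x \<notin> (A - B) \<union> (B - A)" by (rule AE_not_in)
    have eq: "(\<integral>x\<in>A. f x \<partial>M) = (\<integral>x\<in>B. f x \<partial>M)" if [measurable]: "f \<in> borel_measurable M" for f :: "'a \<Rightarrow> real"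
      unfolding set_lebesgue_integral_def
    proof (rule integral_cong_AE)
      show "AE x in M. indicator A x *\<^sub>R f x = indicator B x *\<^sub>R f x"
        using ae by eventually_elim (auto simp: indicator_def)
    qed (use AB in auto)
    show "(\<integral>x\<in>A. X x \<partial>M) = (\<integral>x\<in>A. real_cond_exp M F X x \<partial>M)"
      using F.real_cond_exp_intA[OF X_int B(1)] eq[of X] eq[of "real_cond_exp M F X"] by simp
  next
    show "real_cond_exp M F X \<in> borel_measurable T"
      by (rule measurable_from_subalg[OF TF borel_measurable_cond_exp])
  qed
  have "AE x in M. real_cond_exp M F X x = Y x"
    using T1 T2 by eventually_elim simp
  then have "(\<integral>x. \<bar>real_cond_exp M (G m) X x - real_cond_exp M F X x\<bar> \<partial>M)
    = (\<integral>x. \<bar>real_cond_exp M (G m) X x - Y x\<bar> \<partial>M)" for m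
    by (intro integral_cong_AE) (use Y_int in auto)
  then show ?thesis using lim by simp
qed

end

section \<open>Local sigma-algebras of configurations\<close>

lemma space_FF [simp]: "space (FF J) = UNIV"
  by (simp add: FF_def)

lemma measurable_restrict_FF:
  "(\<lambda>\<omega>. restrict \<omega> J) \<in> measurable (FF J) (PiM J (\<lambda>_. count_space UNIV))"
  unfolding FF_def by (rule measurable_vimage_algebra1) (auto simp: space_PiM)

lemma measurable_site_FF:
  assumes "v \<in> J"
  shows "(\<lambda>\<omega>. \<omega> v) \<in> measurable (FF J) (count_space UNIV)"
proof -
  have "(\<lambda>\<omega>. restrict \<omega> J v) \<in> measurable (FF J) (count_space UNIV)"
    using measurable_compose[OF measurable_restrict_FF measurable_component_singleton[OF assms]] by simp
  then show ?thesis using assms by simp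
qed

lemma sets_FF_least:
  assumes "space N = UNIV" "\<And>v. v \<in> J \<Longrightarrow> (\<lambda>\<omega>. \<omega> v) \<in> measurable N (count_space UNIV)"
  shows "sets (FF J) \<subseteq> sets N"
  unfolding FF_def by (rule sets_image_in_sets[OF assms(1) measurable_restrict[OF assms(2)]])

lemma subalgebra_FF_mono: "I \<subseteq> J \<Longrightarrow> subalgebra (FF J) (FF I)"
  unfolding subalgebra_def using sets_FF_least[of "FF J" I] measurable_site_FF[of _ J] by auto

lemma space_config_space [simp]: "space config_space = UNIV"
  by (auto simp: config_space_def space_PiM)

lemma subalgebra_config_space_FF: "subalgebra config_space (FF J)"
  unfolding subalgebra_def
proof
  show "sets (FF J) \<subseteq> sets config_space"
    by (rule sets_FF_least) (auto simp: config_space_def space_PiM)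
qed simp

text \<open>With a finite alphabet and finitely many sites the product space is discrete, so
  depending on those sites alone already implies measurability.\<close>

lemma measurable_FF_finite:
  fixes g :: "'a::finite config \<Rightarrow> 'b"
  assumes V: "finite V" and g: "\<And>\<omega> \<omega>'. (\<forall>v\<in>V. \<omega> v = \<omega>' v) \<Longrightarrow> g \<omega> = g \<omega>'" and N: "range g \<subseteq> space N"
  shows "g \<in> measurable (FF V) N"
proof (rule measurableI)
  fix B assume "B \<in> sets N"
  let ?r = "\<lambda>\<omega>::'a config. restrict \<omega> V"
  have "PiM V (\<lambda>_. count_space UNIV) = count_space (PiE V (\<lambda>_. UNIV :: 'a set))"
    using V by (intro count_space_PiM_finite) auto
  then have "?r ` (g -` B) \<in> sets (PiM V (\<lambda>_. count_space UNIV))" by auto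
  from measurable_sets[OF measurable_restrict_FF this]
  have "?r -` (?r ` (g -` B)) \<in> sets (FF V)" by simp
  moreover have "?r -` (?r ` (g -` B)) = g -` B"
  proof (intro equalityI subsetI)
    fix \<omega> assume "\<omega> \<in> ?r -` (?r ` (g -` B))"
    then obtain \<eta> where \<eta>: "?r \<omega> = ?r \<eta>" "g \<eta> \<in> B" by auto
    have "\<forall>v\<in>V. \<omega> v = \<eta> v"
    proof
      fix v assume "v \<in> V"
      then show "\<omega> v = \<eta> v" using fun_cong[OF \<eta>(1), of v] by simp
    qed
    from g[OF this] \<eta>(2) show "\<omega> \<in> g -` B" by simp
  qed auto
  ultimately show "g -` B \<inter> space (FF V) \<in> sets (FF V)" by simp
qed (use N in auto)

lemma sets_FF_eq_sigma_sets_Union: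
  fixes J :: "site set" and D :: "nat \<Rightarrow> site set"
  assumes "(\<Union>m. D m) = UNIV"
  shows "sets (FF J :: 'a config measure) = sigma_sets UNIV (\<Union>m. sets (FF (J \<inter> D m)))"
proof
  let ?N = "sigma UNIV (\<Union>m. sets (FF (J \<inter> D m))) :: 'a config measure"
  have N: "sets ?N = sigma_sets UNIV (\<Union>m. sets (FF (J \<inter> D m)))" by (simp add: sets_measure_of)
  have "sets (FF J) \<subseteq> sets ?N"
  proof (rule sets_FF_least)
    fix v assume "v \<in> J"
    then obtain m where m: "v \<in> J \<inter> D m" using assms by blast
    show "(\<lambda>\<omega>. \<omega> v) \<in> measurable ?N (count_space UNIV)"
    proof (rule measurableI)
      fix A :: "'a set"
      have "(\<lambda>\<omega>. \<omega> v) -` A \<in> sets (FF (J \<inter> D m))"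
        using measurable_sets[OF measurable_site_FF[OF m], of A] by simp
      then show "(\<lambda>\<omega>. \<omega> v) -` A \<inter> space ?N \<in> sets ?N"
        unfolding N by (auto simp: space_measure_of_conv)
    qed simp
  qed (simp add: space_measure_of_conv)
  then show "sets (FF J :: 'a config measure) \<subseteq> sigma_sets UNIV (\<Union>m. sets (FF (J \<inter> D m)))" by (simp add: N)
  have "(\<Union>m. sets (FF (J \<inter> D m))) \<subseteq> sets (FF J :: 'a config measure)"
    using subalgebra_FF_mono[of "J \<inter> D _" J] unfolding subalgebra_def by auto
  from sets.sigma_sets_subset[OF this] show "sigma_sets UNIV (\<Union>m. sets (FF (J \<inter> D m))) \<subseteq> sets (FF J :: 'a config measure)"
    by simp
qed

lemma measurable_shift_FF: "shift v \<in> measurable (FF ((\<lambda>u. u + v) ` J)) (FF J)"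
  unfolding FF_def[of J]
  by (rule measurable_vimage_algebra2)
    (auto simp: shift_def intro!: measurable_restrict measurable_site_FF)

lemma shift_shift: "shift u (shift v \<omega>) = shift (u + v) \<omega>"
  by (simp add: shift_def add.assoc)

text \<open>A countable cofinal family of finite sets of sites: limits over all finite sets, as in
  the strong 0-1 law, become limits of sequences.\<close>

definition box :: "nat \<Rightarrow> site set" where
  "box m = {- int m..int m} \<times> {- int m..int m}"

lemma finite_box [simp]: "finite (box m)"
  by (simp add: box_def)

lemma box_mono: "m \<le> n \<Longrightarrow> box m \<subseteq> box n"
  by (auto simp: box_def)

lemma finite_subset_box:
  assumes "finite V"
  shows "\<exists>m. V \<subseteq> box m"
  using assms
proof (induction V rule: finite_induct)
  case (insert v V)
  then obtain m where m: "V \<subseteq> box m" by blast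
  define n where "n = nat (max \<bar>fst v\<bar> \<bar>snd v\<bar>)"
  have "v \<in> box n" by (cases v) (auto simp: box_def n_def)
  then have "insert v V \<subseteq> box (max m n)"
    using m box_mono[of m "max m n"] box_mono[of n "max m n"] by auto
  then show ?case by blast
qed simp

lemma Union_box: "(\<Union>m. box m) = UNIV"
  using finite_subset_box[of "{_}"] by fastforce

section \<open>Stationary fields\<close>

locale random_field = prob_space P for P :: "'a::finite config measure" +
  assumes sets_P: "sets P = sets config_space" and stat: "stationary P"
begin

lemma space_P [simp]: "space P = UNIV"
  using sets_eq_imp_space_eq[OF sets_P] by simp

lemma subalgebra_FF: "subalgebra P (FF J)"
  using subalgebra_config_space_FF sets_P by (auto simp: subalgebra_def)

lemma sets_FF_P: "A \<in> sets (FF J) \<Longrightarrow> A \<in> sets P"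
  using subalgebra_FF[of J] by (auto simp: subalgebra_def)

lemma measurable_FF_P: "f \<in> measurable (FF J) N \<Longrightarrow> f \<in> measurable P N"
  by (rule measurable_from_subalg[OF subalgebra_FF])

lemma measurable_site [measurable]: "(\<lambda>\<omega>. \<omega> v) \<in> measurable P (count_space UNIV)"
  by (rule measurable_FF_P[OF measurable_site_FF[of v UNIV]]) simp

lemma measurable_shift [measurable]: "shift v \<in> measurable P P"
proof -
  have "shift v \<in> measurable config_space config_space"
    unfolding config_space_def
    by (rule measurable_PiM_single') (auto simp: shift_def space_PiM)
  then show ?thesis using measurable_cong_sets[OF sets_P sets_P] by blast
qed

lemma distr_shift: "distr P P (shift v) = P"
  using stat unfolding stationary_def by blast

lemma integral_shift:
  fixes f :: "'a config \<Rightarrow> real"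
  assumes "f \<in> borel_measurable P"
  shows "(\<integral>\<omega>. f (shift v \<omega>) \<partial>P) = (\<integral>\<omega>. f \<omega> \<partial>P)"
  using integral_distr[OF measurable_shift assms, of v] by (simp add: distr_shift)

lemma measure_shift:
  assumes "A \<in> sets P"
  shows "measure P (shift v -` A) = measure P A"
  using measure_distr[OF measurable_shift[of v] assms] by (simp add: distr_shift)

lemma cond_exp_local_limit:
  fixes X :: "'a config \<Rightarrow> real"
  assumes "X \<in> borel_measurable P" "\<And>\<omega>. \<bar>X \<omega>\<bar> \<le> C"
  shows "(\<lambda>m. \<integral>\<omega>. \<bar>real_cond_exp P (FF (J \<inter> box m)) X \<omega> - real_cond_exp P (FF J) X \<omega>\<bar> \<partial>P) \<longlonglongrightarrow> 0"
proof (rule cond_exp_upward[OF subalgebra_FF])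
  show "subalgebra (FF J) (FF (J \<inter> box m))" for m by (rule subalgebra_FF_mono) auto
  show "subalgebra (FF (J \<inter> box n)) (FF (J \<inter> box m))" if "m \<le> n" for m n
    using box_mono[OF that] by (intro subalgebra_FF_mono) auto
  show "sets (FF J) = sigma_sets (space P) (\<Union>m. sets (FF (J \<inter> box m)))"
    using sets_FF_eq_sigma_sets_Union[OF Union_box, of J] by simp
qed (use assms in auto)

section \<open>Second moments of the conditional law at the origin\<close>

lemma borel_measurable_origin [measurable]: "indicat_real {\<eta>. \<eta> (0,0) = y} \<in> borel_measurable P"
  by measurable

lemma cond_law_01: "AE \<omega> in P. 0 \<le> cond_law P (FF J) \<omega> y \<and> cond_law P (FF J) \<omega> y \<le> 1"
proof -
  interpret F: sigma_finite_subalgebra P "FF J" by (rule subalgebra_sigma_finite[OF subalgebra_FF])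
  have i: "integrable P (indicat_real {\<eta>. \<eta> (0,0) = y})"
    by (intro integrable_const_bound[of _ 1]) auto
  show ?thesis unfolding cond_law_def
    by (intro AE_conjI F.real_cond_exp_ge_c F.real_cond_exp_le_c i) auto
qed

lemma measurable_cond_law [measurable]:
  "(\<lambda>\<omega>. cond_law P (FF J) \<omega> y) \<in> borel_measurable P"
  "(\<lambda>\<omega>. cond_law P (FF J) \<omega> y) \<in> borel_measurable (FF J)"
  unfolding cond_law_def by measurable

lemma integrable_cond_law: "integrable P (\<lambda>\<omega>. cond_law P (FF J) \<omega> y)"
  using cond_law_01[of J y] by (intro integrable_const_bound[of _ 1]) auto

text \<open>A scalar stand-in for conditional entropy: monotone in the conditioning set, and, unlike
  entropy, linked to L1 distances by an exact orthogonality identity. Summing over letters lets one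
  number control all of them.\<close>

definition law_sqnorm :: "site set \<Rightarrow> real" where
  "law_sqnorm J = (\<Sum>y\<in>UNIV. \<integral>\<omega>. (cond_law P (FF J) \<omega> y)\<^sup>2 \<partial>P)"

lemma cond_law_sqnorm_mono:
  assumes "I \<subseteq> J"
  shows "(\<integral>\<omega>. (cond_law P (FF I) \<omega> y)\<^sup>2 \<partial>P) \<le> (\<integral>\<omega>. (cond_law P (FF J) \<omega> y)\<^sup>2 \<partial>P)"
  unfolding cond_law_def
  by (rule cond_exp_square_mono[OF subalgebra_FF subalgebra_FF_mono[OF assms], where C = 1])
    (auto simp: indicator_def)

lemma law_sqnorm_mono: "I \<subseteq> J \<Longrightarrow> law_sqnorm I \<le> law_sqnorm J"
  unfolding law_sqnorm_def by (intro sum_mono cond_law_sqnorm_mono)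

text \<open>Every letter contributes a nonnegative increment of the second moment, so the increment
  of a single letter is at most the total one.\<close>

lemma cond_law_L1_dist:
  assumes "I \<subseteq> J"
  shows "(\<integral>\<omega>. \<bar>cond_law P (FF J) \<omega> y - cond_law P (FF I) \<omega> y\<bar> \<partial>P) \<le> sqrt (law_sqnorm J - law_sqnorm I)"
proof -
  let ?s = "\<lambda>J y. \<integral>\<omega>. (cond_law P (FF J) \<omega> y)\<^sup>2 \<partial>P"
  have "(\<integral>\<omega>. \<bar>cond_law P (FF J) \<omega> y - cond_law P (FF I) \<omega> y\<bar> \<partial>P) \<le> sqrt (?s J y - ?s I y)"
    unfolding cond_law_def
    by (rule cond_exp_L1_dist[OF subalgebra_FF subalgebra_FF_mono[OF assms], where C = 1])
      (auto simp: indicator_def)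
  also have "?s J y - ?s I y \<le> (\<Sum>y\<in>UNIV. ?s J y - ?s I y)"
    using cond_law_sqnorm_mono[OF assms] by (intro member_le_sum) auto
  then have "sqrt (?s J y - ?s I y) \<le> sqrt (law_sqnorm J - law_sqnorm I)"
    by (simp add: law_sqnorm_def sum_subtractf)
  finally show ?thesis .
qed

text \<open>Conditional probabilities lie in the unit interval, where squaring has Lipschitz
  constant 2; L1 convergence of the laws therefore suffices.\<close>

lemma law_sqnorm_tendsto:
  assumes "\<And>y. (\<lambda>m::nat. \<integral>\<omega>. \<bar>cond_law P (FF (I m)) \<omega> y - cond_law P (FF J) \<omega> y\<bar> \<partial>P) \<longlonglongrightarrow> 0"
  shows "(\<lambda>m. law_sqnorm (I m)) \<longlonglongrightarrow> law_sqnorm J"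
  unfolding law_sqnorm_def
proof (rule tendsto_sum)
  fix y :: 'a
  let ?q = "\<lambda>J \<omega>. cond_law P (FF J) \<omega> y"
  have sq: "integrable P (\<lambda>\<omega>. (?q J \<omega>)\<^sup>2)" for J
    using cond_law_01[of J y] by (intro integrable_const_bound[of _ 1]) (auto simp: power_le_one)
  have "(\<lambda>m. (\<integral>\<omega>. (?q (I m) \<omega>)\<^sup>2 \<partial>P) - (\<integral>\<omega>. (?q J \<omega>)\<^sup>2 \<partial>P)) \<longlonglongrightarrow> 0"
  proof (rule Lim_null_comparison[OF always_eventually])
    show "(\<lambda>m. 2 * (\<integral>\<omega>. \<bar>?q (I m) \<omega> - ?q J \<omega>\<bar> \<partial>P)) \<longlonglongrightarrow> 0"
      using tendsto_mult_right_zero[OF assms[of y]] by simp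
    show "\<forall>m. norm ((\<integral>\<omega>. (?q (I m) \<omega>)\<^sup>2 \<partial>P) - (\<integral>\<omega>. (?q J \<omega>)\<^sup>2 \<partial>P)) \<le> 2 * (\<integral>\<omega>. \<bar>?q (I m) \<omega> - ?q J \<omega>\<bar> \<partial>P)"
    proof
      fix m
      have "norm ((\<integral>\<omega>. (?q (I m) \<omega>)\<^sup>2 \<partial>P) - (\<integral>\<omega>. (?q J \<omega>)\<^sup>2 \<partial>P)) = norm (\<integral>\<omega>. (?q (I m) \<omega>)\<^sup>2 - (?q J \<omega>)\<^sup>2 \<partial>P)"
        using sq by simp
      also have "\<dots> \<le> (\<integral>\<omega>. norm ((?q (I m) \<omega>)\<^sup>2 - (?q J \<omega>)\<^sup>2) \<partial>P)" by (rule integral_norm_bound)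
      also have "\<dots> \<le> (\<integral>\<omega>. 2 * \<bar>?q (I m) \<omega> - ?q J \<omega>\<bar> \<partial>P)"
      proof (rule integral_mono_AE)
        show "AE \<omega> in P. norm ((?q (I m) \<omega>)\<^sup>2 - (?q J \<omega>)\<^sup>2) \<le> 2 * \<bar>?q (I m) \<omega> - ?q J \<omega>\<bar>"
          using cond_law_01[of J y] cond_law_01[of "I m" y]
        proof eventually_elim
          case (elim \<omega>)
          have "norm ((?q (I m) \<omega>)\<^sup>2 - (?q J \<omega>)\<^sup>2) = \<bar>?q (I m) \<omega> + ?q J \<omega>\<bar> * \<bar>?q (I m) \<omega> - ?q J \<omega>\<bar>"
            by (simp add: abs_mult[symmetric] power2_eq_square algebra_simps)
          also have "\<dots> \<le> 2 * \<bar>?q (I m) \<omega> - ?q J \<omega>\<bar>"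
            using elim by (intro mult_right_mono) auto
          finally show ?case .
        qed
      qed (use sq integrable_cond_law in auto)
      also have "\<dots> = 2 * (\<integral>\<omega>. \<bar>?q (I m) \<omega> - ?q J \<omega>\<bar> \<partial>P)" by simp
      finally show "norm ((\<integral>\<omega>. (?q (I m) \<omega>)\<^sup>2 \<partial>P) - (\<integral>\<omega>. (?q J \<omega>)\<^sup>2 \<partial>P)) \<le> 2 * (\<integral>\<omega>. \<bar>?q (I m) \<omega> - ?q J \<omega>\<bar> \<partial>P)" .
    qed
  qed
  then show "(\<lambda>m. \<integral>\<omega>. (?q (I m) \<omega>)\<^sup>2 \<partial>P) \<longlonglongrightarrow> (\<integral>\<omega>. (?q J \<omega>)\<^sup>2 \<partial>P)" by (rule LIM_zero_cancel)
qed

end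

locale strong_random_field = random_field +
  assumes strong: "strong_01_law P"
begin

text \<open>Every finite set lies in a box, so an event belonging to all the algebras of
  \<open>J \<union> - box m\<close> meets the premise of the strong 0-1 law. This is exactly the
  \<open>tail\<close> hypothesis of the downward limit.\<close>

lemma cond_exp_tail_limit:
  fixes X :: "'a config \<Rightarrow> real"
  assumes "X \<in> borel_measurable P" "\<And>\<omega>. \<bar>X \<omega>\<bar> \<le> C"
  shows "(\<lambda>m. \<integral>\<omega>. \<bar>real_cond_exp P (FF (J \<union> - box m)) X \<omega> - real_cond_exp P (FF J) X \<omega>\<bar> \<partial>P) \<longlonglongrightarrow> 0"
proof (rule cond_exp_downward[OF subalgebra_FF])
  show "subalgebra (FF (J \<union> - box m)) (FF J)" for m by (rule subalgebra_FF_mono) auto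
  show "subalgebra (FF (J \<union> - box m)) (FF (J \<union> - box n))" if "m \<le> n" for m n
    using box_mono[OF that] by (intro subalgebra_FF_mono) auto
  show "\<exists>B\<in>sets (FF J). measure P ((A - B) \<union> (B - A)) = 0"
    if A: "\<And>m. A \<in> sets (FF (J \<union> - box m))" for A
  proof -
    have "A \<in> sets (FF (J \<union> (UNIV - V)))" if V: "finite V" for V
    proof -
      obtain m where "V \<subseteq> box m" using finite_subset_box[OF V] by blast
      then have "subalgebra (FF (J \<union> (UNIV - V))) (FF (J \<union> - box m))"
        by (intro subalgebra_FF_mono) auto
      then show ?thesis using A[of m] by (auto simp: subalgebra_def)
    qed
    then show ?thesis using strong unfolding strong_01_law_def by blast
  qed
qed (use assms in \<open>auto simp: subalgebra_FF\<close>)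

text \<open>Both sets tend to \<open>J\<close>, from outside and from inside. The consequence wanted
  is that every conditioning set agreeing with \<open>J\<close> on \<open>box K\<close> is trapped
  between them, whatever it does outside the box.\<close>

lemma law_sqnorm_sandwich:
  assumes "e > 0"
  shows "\<exists>K. law_sqnorm (J \<union> - box K) - law_sqnorm (J \<inter> box K) < e"
proof -
  have "(\<lambda>m. law_sqnorm (J \<union> - box m)) \<longlonglongrightarrow> law_sqnorm J"
    by (rule law_sqnorm_tendsto, unfold cond_law_def, rule cond_exp_tail_limit[where C = 1]) (auto simp: indicator_def)
  moreover have "(\<lambda>m. law_sqnorm (J \<inter> box m)) \<longlonglongrightarrow> law_sqnorm J"
    by (rule law_sqnorm_tendsto, unfold cond_law_def, rule cond_exp_local_limit[where C = 1]) (auto simp: indicator_def)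
  ultimately have "(\<lambda>m. law_sqnorm (J \<union> - box m) - law_sqnorm (J \<inter> box m)) \<longlonglongrightarrow> law_sqnorm J - law_sqnorm J"
    by (rule tendsto_diff)
  then have "eventually (\<lambda>m. law_sqnorm (J \<union> - box m) - law_sqnorm (J \<inter> box m) < e) sequentially"
    using assms by (intro order_tendstoD) auto
  then show ?thesis using eventually_happens trivial_limit_sequentially by blast
qed

end

section \<open>Conditional information\<close>

lemma mem_sets_FF_cong:
  assumes "A \<in> sets (FF J)" and "\<And>v. v \<in> J \<Longrightarrow> \<omega> v = \<eta> v"
  shows "\<omega> \<in> A \<longleftrightarrow> \<eta> \<in> A"
proof -
  have "(\<lambda>\<omega>::'a config. restrict \<omega> J) \<in> UNIV \<rightarrow> space (PiM J (\<lambda>_. count_space UNIV))"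
    by (auto simp: space_PiM)
  from sets_vimage_algebra2[OF this] obtain B where "A = (\<lambda>\<omega>. restrict \<omega> J) -` B \<inter> UNIV"
    using assms(1) unfolding FF_def by auto
  moreover have "restrict \<omega> J = restrict \<eta> J" using assms(2) by (auto simp: restrict_def)
  ultimately show ?thesis by simp
qed

lemma borel_measurable_FF_cong:
  fixes f :: "'a config \<Rightarrow> real"
  assumes "f \<in> borel_measurable (FF J)" and "\<And>v. v \<in> J \<Longrightarrow> \<omega> v = \<eta> v"
  shows "f \<omega> = f \<eta>"
proof -
  have "f -` {f \<eta>} \<in> sets (FF J)" using measurable_sets[OF assms(1), of "{f \<eta>}"] by simp
  from mem_sets_FF_cong[OF this assms(2)] show ?thesis by simp
qed

lemma cylinder_in_sets_FF:
  fixes \<omega> :: "'a::finite config"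
  assumes "finite V"
  shows "{\<eta>. \<forall>v\<in>V. \<eta> v = \<omega> v} \<in> sets (FF V)"
proof -
  have "(\<lambda>\<eta>. \<forall>v\<in>V. \<eta> v = \<omega> v) \<in> measurable (FF V) (count_space UNIV)"
    using assms by (rule measurable_FF_finite) auto
  then show ?thesis by (simp add: pred_def)
qed

lemma abs_ln_diff_le:
  assumes "(c::real) > 0" "a \<ge> c" "b \<ge> c"
  shows "\<bar>ln a - ln b\<bar> \<le> \<bar>a - b\<bar> / c"
proof -
  have *: "ln a - ln b \<le> \<bar>a - b\<bar> / c" if "a \<ge> c" "b \<ge> c" for a b
  proof -
    have "ln a - ln b \<le> (a - b) / b" using that assms(1) by (intro ln_diff_le) auto
    also have "\<dots> \<le> \<bar>a - b\<bar> / b" using that assms(1) by (intro divide_right_mono) auto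
    also have "\<dots> \<le> \<bar>a - b\<bar> / c" using that assms(1) by (intro divide_left_mono) auto
    finally show ?thesis .
  qed
  from *[OF assms(2,3)] *[OF assms(3,2)] show ?thesis by (auto simp: abs_minus_commute)
qed

lemma (in prob_space) set_integral_indicator:
  assumes "A \<in> sets M" "B \<in> sets M"
  shows "(\<integral>x\<in>A. indicat_real B x \<partial>M) = prob (B \<inter> A)"
proof -
  have "(\<lambda>x. indicat_real A x *\<^sub>R indicat_real B x) = indicator (B \<inter> A)"
    by (auto simp: indicator_def)
  then show ?thesis using assms by (simp add: set_lebesgue_integral_def)
qed

context random_field
begin

lemma sets_origin [measurable]: "{\<eta>. \<eta> (0,0) = y} \<in> sets P"
proof -
  have "{\<eta> \<in> space P. \<eta> (0,0) = y} \<in> sets P" by measurable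
  then show ?thesis by simp
qed

lemma sets_cylinder: "finite V \<Longrightarrow> {\<eta>. \<forall>v\<in>V. \<eta> v = \<omega> v} \<in> sets P"
  by (rule sets_FF_P[OF cylinder_in_sets_FF])

lemma cyl_prob_translate:
  assumes "finite V"
  shows "cyl_prob P ((\<lambda>u. u + v) ` V) \<omega> = cyl_prob P V (shift v \<omega>)"
proof -
  have "{\<eta>. \<forall>u\<in>(\<lambda>u. u + v) ` V. \<eta> u = \<omega> u} = shift v -` {\<eta>. \<forall>u\<in>V. \<eta> u = shift v \<omega> u}"
    by (auto simp: shift_def)
  then show ?thesis unfolding cyl_prob_def
    using measure_shift[OF sets_cylinder[OF assms]] by simp
qed

lemma info_translate: "finite V \<Longrightarrow> info P ((\<lambda>u. u + v) ` V) \<omega> = info P V (shift v \<omega>)"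
  by (simp add: info_def cyl_prob_translate)

lemma info_empty [simp]: "info P {} \<omega> = 0"
  using prob_space by (simp add: info_def cyl_prob_def)

lemma cyl_prob_mono: "finite V \<Longrightarrow> U \<subseteq> V \<Longrightarrow> cyl_prob P V \<omega> \<le> cyl_prob P U \<omega>"
  unfolding cyl_prob_def
  by (intro finite_measure_mono sets_cylinder) (auto intro: finite_subset)

end

text \<open>The witness of condition (B) becomes a parameter because it enters the later bounds, as
  \<open>- ln c\<close> for informations and as \<open>CARD('a) / c\<close> for a Lipschitz
  constant.\<close>

locale bounded_random_field = strong_random_field +
  fixes c :: real
  assumes c_pos: "c > 0"
    and c_lower: "\<And>y A. A \<in> sets (FF (UNIV - {(0,0)})) \<Longrightarrow> measure P A > 0 \<Longrightarrow>
      measure P ({\<omega>. \<omega> (0,0) = y} \<inter> A) / measure P A > c"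
begin

lemma c_lower': "(0,0) \<notin> J \<Longrightarrow> A \<in> sets (FF J) \<Longrightarrow> measure P A > 0 \<Longrightarrow>
    c * measure P A < measure P ({\<omega>. \<omega> (0,0) = y} \<inter> A)"
  using c_lower[of A y] subalgebra_FF_mono[of J "UNIV - {(0,0)}"]
  by (auto simp: subalgebra_def field_simps)

lemma c_less_1: "c < 1"
proof -
  have "c * measure P UNIV < measure P ({\<omega>. \<omega> (0,0) = undefined} \<inter> UNIV)"
    using prob_space by (intro c_lower'[of "{}"]) (auto simp: sets.top[of "FF {}", simplified])
  also have "\<dots> \<le> 1" by simp
  finally show ?thesis using prob_space by simp
qed

lemma cyl_prob_insert_origin:
  assumes "finite J" "(0,0) \<notin> J" "cyl_prob P J \<omega> > 0"
  shows "c * cyl_prob P J \<omega> < cyl_prob P (insert (0,0) J) \<omega>"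
proof -
  have "{\<eta>. \<eta> (0,0) = \<omega> (0,0)} \<inter> {\<eta>. \<forall>v\<in>J. \<eta> v = \<omega> v} = {\<eta>. \<forall>v\<in>insert (0,0) J. \<eta> v = \<omega> v}"
    by auto
  then show ?thesis
    using c_lower'[OF assms(2) cylinder_in_sets_FF[OF assms(1)], of \<omega> "\<omega> (0,0)"] assms(3)
    by (simp add: cyl_prob_def)
qed

text \<open>Condition (B) speaks about the origin only, so the site added in the induction is
  translated to the origin first; there each new symbol costs at most a factor
  \<open>c\<close>.\<close>

lemma cyl_prob_pos:
  assumes "finite V"
  shows "cyl_prob P V \<omega> > 0"
  using assms
proof (induction V arbitrary: \<omega> rule: finite_induct)
  case empty
  then show ?case using prob_space by (simp add: cyl_prob_def)
next
  case (insert v V)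
  let ?J = "(\<lambda>u. u - v) ` V"
  have V: "(\<lambda>u. u + v) ` ?J = V" by (simp add: image_image)
  have iV: "(\<lambda>u. u + v) ` insert (0,0) ?J = insert v V"
    by (simp add: image_image flip: zero_prod_def)
  have "cyl_prob P ?J (shift v \<omega>) > 0"
    using cyl_prob_translate[of ?J v \<omega>] insert.IH[of \<omega>] insert.hyps unfolding V by simp
  moreover have "(0,0) \<notin> ?J" using insert.hyps by (auto simp flip: zero_prod_def)
  ultimately have "cyl_prob P (insert (0,0) ?J) (shift v \<omega>) > 0"
    using cyl_prob_insert_origin[of ?J "shift v \<omega>"] insert.hyps c_pos
    by (smt (verit) finite_imageI mult_pos_pos)
  then show ?case using cyl_prob_translate[of "insert (0,0) ?J" v \<omega>] insert.hyps iV by simp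
qed

text \<open>The event that the conditional probability of \<open>y\<close> is below \<open>c\<close>
  belongs to \<open>FF J\<close>. If it had positive probability, averaging over it would contradict
  condition (B) for that very event.\<close>

lemma cond_law_lower:
  assumes "(0,0) \<notin> J"
  shows "AE \<omega> in P. \<forall>y. c \<le> cond_law P (FF J) \<omega> y"
proof -
  interpret F: sigma_finite_subalgebra P "FF J" by (rule subalgebra_sigma_finite[OF subalgebra_FF])
  have "AE \<omega> in P. c \<le> cond_law P (FF J) \<omega> y" for y
  proof -
    let ?A = "{\<omega>. cond_law P (FF J) \<omega> y < c}"
    have "{\<omega> \<in> space (FF J). cond_law P (FF J) \<omega> y < c} \<in> sets (FF J)" by measurable
    then have A: "?A \<in> sets (FF J)" by simp
    then have AP: "?A \<in> sets P" by (rule sets_FF_P)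
    have int: "integrable P (indicat_real {\<eta>. \<eta> (0,0) = y})"
      by (intro integrable_const_bound[of _ 1]) auto
    have ind: "integrable P (\<lambda>\<omega>. indicat_real ?A \<omega> * c)"
      using AP by (simp add: emeasure_eq_measure)
    have "measure P ({\<omega>. \<omega> (0,0) = y} \<inter> ?A) = (\<integral>\<omega>\<in>?A. indicat_real {\<eta>. \<eta> (0,0) = y} \<omega> \<partial>P)"
      by (rule set_integral_indicator[symmetric, OF AP sets_origin])
    also have "\<dots> = (\<integral>\<omega>\<in>?A. cond_law P (FF J) \<omega> y \<partial>P)"
      unfolding cond_law_def using A by (intro F.real_cond_exp_intA int) (simp add: cond_law_def)
    also have "\<dots> \<le> (\<integral>\<omega>. indicator ?A \<omega> * c \<partial>P)"
      unfolding set_lebesgue_integral_def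
      by (intro integral_mono integrable_mult_indicator[OF AP integrable_cond_law] ind)
        (auto simp: indicator_def)
    also have "\<dots> = c * measure P ?A" using AP by simp
    finally have "measure P ?A = 0"
      using c_lower'[OF assms A, of y] zero_less_measure_iff by fastforce
    then have "?A \<in> null_sets P" using AP by (simp add: null_sets_def emeasure_eq_measure)
    then have "AE \<omega> in P. \<omega> \<notin> ?A" by (rule AE_not_in)
    then show ?thesis by eventually_elim auto
  qed
  then show ?thesis by (simp add: AE_all_countable)
qed

definition cond_info :: "site set \<Rightarrow> 'a config \<Rightarrow> real" where
  "cond_info J \<omega> = - ln (cond_law P (FF J) \<omega> (\<omega> (0,0)))"

text \<open>For finite \<open>J\<close> the conditional law is constant on the cylinders over \<open>J\<close>, all of which have
  positive probability, so the identity holds everywhere and not only almost everywhere.\<close>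

lemma cond_law_finite:
  assumes J: "finite J" "(0,0) \<notin> J"
  shows "cond_law P (FF J) \<omega> (\<omega> (0,0)) = cyl_prob P (insert (0,0) J) \<omega> / cyl_prob P J \<omega>"
proof -
  interpret F: sigma_finite_subalgebra P "FF J" by (rule subalgebra_sigma_finite[OF subalgebra_FF])
  let ?y = "\<omega> (0,0)" and ?A = "{\<eta>. \<forall>v\<in>J. \<eta> v = \<omega> v}"
  have A: "?A \<in> sets (FF J)" "?A \<in> sets P" using cylinder_in_sets_FF sets_cylinder J by auto
  have int: "integrable P (indicat_real {\<eta>. \<eta> (0,0) = ?y})"
    by (intro integrable_const_bound[of _ 1]) auto
  have "cyl_prob P (insert (0,0) J) \<omega> = measure P ({\<eta>. \<eta> (0,0) = ?y} \<inter> ?A)"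
    unfolding cyl_prob_def by (intro arg_cong[where f = "measure P"]) auto
  also have "\<dots> = (\<integral>\<eta>\<in>?A. indicat_real {\<eta>. \<eta> (0,0) = ?y} \<eta> \<partial>P)"
    by (rule set_integral_indicator[symmetric, OF A(2) sets_origin])
  also have "\<dots> = (\<integral>\<eta>\<in>?A. cond_law P (FF J) \<eta> ?y \<partial>P)"
    unfolding cond_law_def by (intro F.real_cond_exp_intA int A)
  also have "\<dots> = (\<integral>\<eta>. indicator ?A \<eta> * cond_law P (FF J) \<omega> ?y \<partial>P)"
    unfolding set_lebesgue_integral_def
  proof (intro Bochner_Integration.integral_cong refl)
    fix \<eta>
    have "cond_law P (FF J) \<eta> ?y = cond_law P (FF J) \<omega> ?y" if "\<eta> \<in> ?A"
      using that by (intro borel_measurable_FF_cong[OF measurable_cond_law(2)]) auto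
    then show "indicat_real ?A \<eta> *\<^sub>R cond_law P (FF J) \<eta> ?y = indicator ?A \<eta> * cond_law P (FF J) \<omega> ?y"
      by (auto simp: indicator_def)
  qed
  also have "\<dots> = cyl_prob P J \<omega> * cond_law P (FF J) \<omega> ?y" using A by (simp add: cyl_prob_def)
  finally show ?thesis using cyl_prob_pos[OF J(1), of \<omega>] by (simp add: field_simps)
qed

lemma cond_info_finite:
  assumes J: "finite J" "(0,0) \<notin> J"
  shows "cond_info J \<omega> = info P (insert (0,0) J) \<omega> - info P J \<omega>"
proof -
  have "cyl_prob P (insert (0,0) J) \<omega> > 0" "cyl_prob P J \<omega> > 0" using J by (auto intro!: cyl_prob_pos)
  then show ?thesis by (simp add: cond_info_def cond_law_finite[OF J] info_def ln_div)
qed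

lemma cond_info_bounds:
  assumes J: "finite J" "(0,0) \<notin> J"
  shows "0 \<le> cond_info J \<omega>" "cond_info J \<omega> \<le> - ln c"
proof -
  let ?p = "cyl_prob P (insert (0,0) J) \<omega>" and ?q = "cyl_prob P J \<omega>"
  have p: "?p > 0" "?q > 0" using J by (auto intro!: cyl_prob_pos)
  have "?p \<le> ?q" using J by (intro cyl_prob_mono) auto
  moreover have "c * ?q < ?p" using J p by (intro cyl_prob_insert_origin) auto
  ultimately have "c \<le> ?p / ?q" "?p / ?q \<le> 1" using p by (auto simp: field_simps)
  moreover have "ln c \<le> ln (?p / ?q)" "ln (?p / ?q) \<le> 0"
    using calculation p c_pos by (auto intro!: ln_mono divide_pos_pos)
  ultimately show "0 \<le> cond_info J \<omega>" "cond_info J \<omega> \<le> - ln c"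
    by (auto simp: cond_info_def cond_law_finite[OF J])
qed

lemma measurable_cond_info_FF:
  assumes J: "finite J" "(0,0) \<notin> J"
  shows "cond_info J \<in> borel_measurable (FF (insert (0,0) J))"
proof (rule measurable_FF_finite)
  fix \<omega> \<omega>' :: "'a config" assume "\<forall>v\<in>insert (0,0) J. \<omega> v = \<omega>' v"
  then have "cyl_prob P (insert (0,0) J) \<omega> = cyl_prob P (insert (0,0) J) \<omega>'"
    "cyl_prob P J \<omega> = cyl_prob P J \<omega>'"
    unfolding cyl_prob_def by (auto intro!: arg_cong[where f = "measure P"])
  then show "cond_info J \<omega> = cond_info J \<omega>'" by (simp add: cond_info_finite[OF J] info_def)
qed (use J in auto)

lemma cond_info_eq_sum:
  "cond_info J \<omega> = (\<Sum>y\<in>UNIV. - ln (cond_law P (FF J) \<omega> y) * indicator {\<eta>. \<eta> (0,0) = y} \<omega>)"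
proof -
  have "(\<Sum>y\<in>UNIV. - ln (cond_law P (FF J) \<omega> y) * indicator {\<eta>. \<eta> (0,0) = y} \<omega>)
      = (\<Sum>y\<in>UNIV. if \<omega> (0,0) = y then - ln (cond_law P (FF J) \<omega> y) else 0)"
    by (intro sum.cong) (auto simp: indicator_def)
  then show ?thesis by (simp add: cond_info_def)
qed

lemma measurable_cond_info [measurable]: "cond_info J \<in> borel_measurable P"
  unfolding cond_info_eq_sum[abs_def] by measurable

lemma cond_info_AE_bound:
  assumes "(0,0) \<notin> J"
  shows "AE \<omega> in P. \<bar>cond_info J \<omega>\<bar> \<le> - ln c"
proof -
  have "AE \<omega> in P. \<forall>y. cond_law P (FF J) \<omega> y \<le> 1" 
    using cond_law_01[of J] by (simp add: AE_all_countable AE_conj_iff)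
  then show ?thesis using cond_law_lower[OF assms]
  proof eventually_elim
    case (elim \<omega>)
    then have "c \<le> cond_law P (FF J) \<omega> (\<omega> (0,0))" "cond_law P (FF J) \<omega> (\<omega> (0,0)) \<le> 1" by auto
    then have "ln c \<le> ln (cond_law P (FF J) \<omega> (\<omega> (0,0)))" "ln (cond_law P (FF J) \<omega> (\<omega> (0,0))) \<le> 0"
      using c_pos by (auto intro!: ln_mono)
    then show ?case by (simp add: cond_info_def)
  qed
qed

lemma integrable_cond_info: "(0,0) \<notin> J \<Longrightarrow> integrable P (cond_info J)"
  using cond_info_AE_bound by (intro integrable_const_bound[of _ "- ln c"]) auto

text \<open>The logarithm is measurable for \<open>FF J\<close>, so in each summand the indicator of
  the origin symbol may be replaced by its conditional probability. This turns mean information into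
  the entropy in \<open>h_slope\<close>.\<close>

lemma integral_cond_info:
  assumes "(0,0) \<notin> J"
  shows "(\<integral>\<omega>. cond_info J \<omega> \<partial>P) = (\<integral>\<omega>. entropy_fin (cond_law P (FF J) \<omega>) \<partial>P)"
proof -
  interpret F: sigma_finite_subalgebra P "FF J" by (rule subalgebra_sigma_finite[OF subalgebra_FF])
  have ln_bd: "AE \<omega> in P. \<bar>- ln (cond_law P (FF J) \<omega> y)\<bar> \<le> - ln c" for y
    using cond_law_lower[OF assms] cond_law_01[of J y]
  proof eventually_elim
    case (elim \<omega>)
    then have "c \<le> cond_law P (FF J) \<omega> y" "cond_law P (FF J) \<omega> y \<le> 1" by auto
    then have "ln c \<le> ln (cond_law P (FF J) \<omega> y)" "ln (cond_law P (FF J) \<omega> y) \<le> 0"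
      using c_pos by (auto intro!: ln_mono)
    then show ?case by simp
  qed
  have i1: "integrable P (\<lambda>\<omega>. - ln (cond_law P (FF J) \<omega> y) * indicat_real {\<eta>. \<eta> (0,0) = y} \<omega>)" for y
    by (rule integrable_bounded_mult[OF _ _ ln_bd, where D = 1]) (auto simp: indicator_def)
  have i2: "integrable P (\<lambda>\<omega>. - ln (cond_law P (FF J) \<omega> y) * cond_law P (FF J) \<omega> y)" for y
    using cond_law_01[of J y] by (intro integrable_bounded_mult[OF _ _ ln_bd, where D = 1]) auto
  have "(\<integral>\<omega>. cond_info J \<omega> \<partial>P)
      = (\<Sum>y\<in>UNIV. \<integral>\<omega>. - ln (cond_law P (FF J) \<omega> y) * indicat_real {\<eta>. \<eta> (0,0) = y} \<omega> \<partial>P)"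
    unfolding cond_info_eq_sum by (rule Bochner_Integration.integral_sum) (rule i1)
  also have "\<dots> = (\<Sum>y\<in>UNIV. \<integral>\<omega>. - ln (cond_law P (FF J) \<omega> y) * cond_law P (FF J) \<omega> y \<partial>P)"
  proof (rule sum.cong[OF refl])
    fix y :: 'a
    have "(\<lambda>\<omega>. - ln (cond_law P (FF J) \<omega> y)) \<in> borel_measurable (FF J)" by measurable
    from F.real_cond_exp_intg(2)[OF i1 this]
    show "(\<integral>\<omega>. - ln (cond_law P (FF J) \<omega> y) * indicat_real {\<eta>. \<eta> (0,0) = y} \<omega> \<partial>P)
      = (\<integral>\<omega>. - ln (cond_law P (FF J) \<omega> y) * cond_law P (FF J) \<omega> y \<partial>P)"
      by (simp add: cond_law_def)
  qed
  also have "\<dots> = (\<integral>\<omega>. (\<Sum>y\<in>UNIV. - ln (cond_law P (FF J) \<omega> y) * cond_law P (FF J) \<omega> y) \<partial>P)"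
    by (rule Bochner_Integration.integral_sum[symmetric]) (rule i2)
  also have "\<dots> = (\<integral>\<omega>. entropy_fin (cond_law P (FF J) \<omega>) \<partial>P)"
    by (simp add: entropy_fin_def sum_negf mult.commute)
  finally show ?thesis .
qed

text \<open>Both laws are at least \<open>c\<close>, where the logarithm has Lipschitz constant
  \<open>1 / c\<close>. Which letter occupies the origin is random, so the differences of all
  letters are added, whence the factor \<open>CARD('a)\<close>.\<close>

lemma cond_info_L1_dist:
  assumes IJ: "I \<subseteq> J" and J: "(0,0) \<notin> J"
  shows "(\<integral>\<omega>. \<bar>cond_info J \<omega> - cond_info I \<omega>\<bar> \<partial>P)
    \<le> CARD('a) / c * sqrt (law_sqnorm J - law_sqnorm I)"
proof -
  let ?d = "\<lambda>y \<omega>. \<bar>cond_law P (FF J) \<omega> y - cond_law P (FF I) \<omega> y\<bar>"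
  have I: "(0,0) \<notin> I" using assms by auto
  have d: "integrable P (?d y)" for y by (intro integrable_abs Bochner_Integration.integrable_diff integrable_cond_law)
  have "(\<integral>\<omega>. \<bar>cond_info J \<omega> - cond_info I \<omega>\<bar> \<partial>P) \<le> (\<integral>\<omega>. (\<Sum>y\<in>UNIV. ?d y \<omega>) / c \<partial>P)"
  proof (rule integral_mono_AE)
    show "AE \<omega> in P. \<bar>cond_info J \<omega> - cond_info I \<omega>\<bar> \<le> (\<Sum>y\<in>UNIV. ?d y \<omega>) / c"
      using cond_law_lower[OF I] cond_law_lower[OF J]
    proof eventually_elim
      case (elim \<omega>)
      have "\<bar>cond_info J \<omega> - cond_info I \<omega>\<bar>
          = \<bar>ln (cond_law P (FF J) \<omega> (\<omega> (0,0))) - ln (cond_law P (FF I) \<omega> (\<omega> (0,0)))\<bar>"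
        by (simp add: cond_info_def abs_minus_commute)
      also have "\<dots> \<le> ?d (\<omega> (0,0)) \<omega> / c"
        using elim c_pos by (intro abs_ln_diff_le) auto
      also have "\<dots> \<le> (\<Sum>y\<in>UNIV. ?d y \<omega>) / c"
        using c_pos by (intro divide_right_mono member_le_sum) auto
      finally show ?case .
    qed
  qed (use I J d integrable_cond_info in auto)
  also have "\<dots> = (\<Sum>y\<in>UNIV. \<integral>\<omega>. ?d y \<omega> \<partial>P) / c"
    using d by (simp add: Bochner_Integration.integral_sum)
  also have "\<dots> \<le> (\<Sum>y\<in>(UNIV :: 'a set). sqrt (law_sqnorm J - law_sqnorm I)) / c"
    using c_pos by (intro divide_right_mono sum_mono cond_law_L1_dist[OF IJ]) auto
  finally show ?thesis by simp
qed

end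

section \<open>Lattice approximations of lines\<close>

lemma origin_notin_Lline: "U \<subseteq> {z. z \<le> -1} \<Longrightarrow> (0,0) \<notin> Lline lam t U"
  by (auto simp: Lline_def)

lemma Lline_mono: "U \<subseteq> W \<Longrightarrow> Lline lam t U \<subseteq> Lline lam t W"
  by (auto simp: Lline_def)

lemma Lline_eq_image: "Lline lam t U = (\<lambda>z. (z, \<lfloor>lam * of_int z + t\<rfloor>)) ` U"
  by (auto simp: Lline_def)

lemma finite_Lline [simp]: "finite U \<Longrightarrow> finite (Lline lam t U)"
  by (simp add: Lline_eq_image)

lemma eventually_floor_at_right: "eventually (\<lambda>s. \<lfloor>a + s\<rfloor> = \<lfloor>a + t\<rfloor>) (at_right (t::real))"
  unfolding eventually_at_right_field
  by (rule exI[of _ "of_int \<lfloor>a + t\<rfloor> + 1 - a"]) (auto simp: floor_eq_iff; linarith)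

text \<open>The left limit of the floor: \<open>\<lceil>a + t\<rceil> - 1\<close> is the ordinary
  floor when \<open>a + t\<close> is not an integer and one less when it is.\<close>

lemma eventually_floor_at_left: "eventually (\<lambda>s. \<lfloor>a + s\<rfloor> = \<lceil>a + t\<rceil> - 1) (at_left (t::real))"
  unfolding eventually_at_left_field
  by (rule exI[of _ "of_int \<lceil>a + t\<rceil> - 1 - a"]) (auto simp: floor_eq_iff; linarith)

context strong_random_field
begin

text \<open>Columns to the left of \<open>- K\<close> lie outside the box, and in the other columns
  line and graph coincide; hence the full and the truncated past are both trapped in the sandwich.
  The graph \<open>g\<close> is arbitrary because the left limits of pasts need not be pasts of
  lines.\<close>

lemma law_sqnorm_near_graph:
  fixes g :: "int \<Rightarrow> int"
  assumes K: "law_sqnorm ({(z, g z) | z. z \<le> -1} \<union> - box K) - law_sqnorm ({(z, g z) | z. z \<le> -1} \<inter> box K) < e"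
    and s: "\<forall>z\<in>{- int K..-1}. \<lfloor>lam * of_int z + s\<rfloor> = g z"
  shows "law_sqnorm (Lline lam s {z. z \<le> -1}) - law_sqnorm (Lline lam s {- int K..-1}) \<le> e"
proof -
  have "Lline lam s {z. z \<le> -1} \<subseteq> {(z, g z) | z. z \<le> -1} \<union> - box K"
    using s by (auto simp: Lline_def box_def)
  moreover have "{(z, g z) | z. z \<le> -1} \<inter> box K \<subseteq> Lline lam s {- int K..-1}"
    using s by (auto simp: Lline_def box_def)
  ultimately show ?thesis using K by (smt (verit) law_sqnorm_mono)
qed

text \<open>Pasts of nearby lines agree with that of the limiting line (approached from the right), or
  with the graph of \<open>\<lceil>lam * z + t\<rceil> - 1\<close> (approached from the left), in a large box; the strong 0-1 law
  makes the part outside the box irrelevant, and compactness of the unit interval gives uniformity.\<close>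

lemma law_sqnorm_uniform:
  assumes e: "e > 0"
  shows "\<exists>K. \<forall>t\<in>{0..1}. law_sqnorm (Lline lam t {z. z \<le> -1}) - law_sqnorm (Lline lam t {- int K..-1}) \<le> e"
proof -
  let ?d = "\<lambda>K t. law_sqnorm (Lline lam t {z. z \<le> -1}) - law_sqnorm (Lline lam t {- int K..-1})"
  \<comment> \<open>The gap shrinks as \<open>K\<close> grows, so depths found on two pieces can be
    replaced by their maximum.\<close>
  have mono: "?d K' t \<le> ?d K t" if "K \<le> K'" for K K' t
    using law_sqnorm_mono[OF Lline_mono[of "{- int K..-1}" "{- int K'..-1}" lam t]] that by auto
  define Q where "Q a b \<longleftrightarrow> (\<exists>K. \<forall>t\<in>{a..b}. ?d K t \<le> e)" for a b :: real
  have "Q 0 1"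
  \<comment> \<open>Compactness by bisection: the property passes to the union of adjacent
    intervals, and it holds on all sufficiently short intervals around each point.\<close>
  proof (rule Bolzano)
    fix a b c assume "Q a b" "Q b c"
    then obtain K1 K2 where K: "\<forall>t\<in>{a..b}. ?d K1 t \<le> e" "\<forall>t\<in>{b..c}. ?d K2 t \<le> e"
      unfolding Q_def by blast
    have "?d (max K1 K2) t \<le> e" if "t \<in> {a..c}" for t
    proof (cases "t \<le> b")
      case True
      then show ?thesis using K(1) that by (intro order_trans[OF mono[of K1 "max K1 K2" t]]) auto
    next
      case False
      then show ?thesis using K(2) that by (intro order_trans[OF mono[of K2 "max K1 K2" t]]) auto
    qed
    then show "Q a c" unfolding Q_def by blast
  next
    fix t :: real
    obtain K1 where K1: "law_sqnorm ({(z, \<lfloor>lam * of_int z + t\<rfloor>) | z. z \<le> -1} \<union> - box K1)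
        - law_sqnorm ({(z, \<lfloor>lam * of_int z + t\<rfloor>) | z. z \<le> -1} \<inter> box K1) < e"
      using law_sqnorm_sandwich[OF e] by blast
    obtain K2 where K2: "law_sqnorm ({(z, \<lceil>lam * of_int z + t\<rceil> - 1) | z. z \<le> -1} \<union> - box K2)
        - law_sqnorm ({(z, \<lceil>lam * of_int z + t\<rceil> - 1) | z. z \<le> -1} \<inter> box K2) < e"
      using law_sqnorm_sandwich[OF e] by blast
    have "eventually (\<lambda>s. \<forall>z\<in>{- int K1..-1}. \<lfloor>lam * of_int z + s\<rfloor> = \<lfloor>lam * of_int z + t\<rfloor>) (at_right t)"
      by (intro eventually_ball_finite ballI eventually_floor_at_right) auto
    then obtain r where r: "r > t" "\<And>s. t < s \<Longrightarrow> s < r \<Longrightarrow> \<forall>z\<in>{- int K1..-1}. \<lfloor>lam * of_int z + s\<rfloor> = \<lfloor>lam * of_int z + t\<rfloor>"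
      unfolding eventually_at_right_field by blast
    have "eventually (\<lambda>s. \<forall>z\<in>{- int K2..-1}. \<lfloor>lam * of_int z + s\<rfloor> = \<lceil>lam * of_int z + t\<rceil> - 1) (at_left t)"
      by (intro eventually_ball_finite ballI eventually_floor_at_left) auto
    then obtain l where l: "l < t" "\<And>s. l < s \<Longrightarrow> s < t \<Longrightarrow> \<forall>z\<in>{- int K2..-1}. \<lfloor>lam * of_int z + s\<rfloor> = \<lceil>lam * of_int z + t\<rceil> - 1"
      unfolding eventually_at_left_field by blast
    have near: "?d (max K1 K2) s \<le> e" if "l < s" "s < r" for s
    \<comment> \<open>The point \<open>s = t\<close> goes with the right-hand side, since the floor
      is continuous from the right.\<close>
    proof (cases "t \<le> s")
      case True
      then have "\<forall>z\<in>{- int K1..-1}. \<lfloor>lam * of_int z + s\<rfloor> = \<lfloor>lam * of_int z + t\<rfloor>"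
        using r(2)[of s] that by (cases "s = t") auto
      from law_sqnorm_near_graph[OF K1 this] show ?thesis using mono[of K1 "max K1 K2" s] by simp
    next
      case False
      then show ?thesis using law_sqnorm_near_graph[OF K2 l(2)[of s]] that mono[of K2 "max K1 K2" s] by simp
    qed
    show "\<exists>d>0. \<forall>a b. a \<le> t \<and> t \<le> b \<and> b - a < d \<longrightarrow> Q a b"
    proof (intro exI[of _ "min (r - t) (t - l)"] conjI allI impI)
      fix a b assume *: "a \<le> t \<and> t \<le> b \<and> b - a < min (r - t) (t - l)"
      have "?d (max K1 K2) s \<le> e" if "s \<in> {a..b}" for s
        using * that by (intro near) auto
      then show "Q a b" unfolding Q_def by blast
    qed (use r(1) l(1) in auto)
  qed simp
  then show ?thesis by (simp add: Q_def)
qed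

end

section \<open>Step functions along a rotation\<close>

lemma threshold_representation:
  fixes \<phi> :: "real \<Rightarrow> real"
  assumes "finite D"
    and "\<And>s t. s \<in> {0..<1} \<Longrightarrow> t \<in> {0..<1} \<Longrightarrow> (\<forall>d\<in>D. d \<le> s \<longleftrightarrow> d \<le> t) \<Longrightarrow> \<phi> s = \<phi> t"
  shows "\<exists>b a. \<forall>t\<in>{0..<1}. \<phi> t = b + (\<Sum>d\<in>D. a d * indicator {d..} t)"
  using assms
proof (induction D arbitrary: \<phi> rule: finite_linorder_max_induct)
  case empty
  have "\<phi> t = \<phi> 0 + (\<Sum>d\<in>{}. 0 * indicator {d..} t)" if "t \<in> {0..<1}" for t
    using empty.prems[of t 0] that by simp
  then show ?case by (intro exI ballI)
next
  case (insert m D)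
  show ?case
  proof (cases "0 < m \<and> m < 1")
    case False
    \<comment> \<open>A threshold outside the open unit interval separates no two points of
      \<open>{0..<1}\<close> and receives the coefficient 0.\<close>
    have "\<phi> s = \<phi> t" if "s \<in> {0..<1}" "t \<in> {0..<1}" "\<forall>d\<in>D. d \<le> s \<longleftrightarrow> d \<le> t" for s t
      using insert.prems[OF that(1,2)] that False by auto
    from insert.IH[of \<phi>, OF this] obtain b a
      where ab: "\<forall>t\<in>{0..<1}. \<phi> t = b + (\<Sum>d\<in>D. a d * indicator {d..} t)" by blast
    have "\<phi> t = b + (\<Sum>d\<in>insert m D. (a(m := 0)) d * indicator {d..} t)" if "t \<in> {0..<1}" for t
    proof -
      have "(\<Sum>d\<in>insert m D. (a(m := 0)) d * indicator {d..} t) = (\<Sum>d\<in>D. (a(m := 0)) d * indicator {d..} t)"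
        using insert.hyps by (subst sum.insert) auto
      also have "\<dots> = (\<Sum>d\<in>D. a d * indicator {d..} t)"
        using insert.hyps by (intro sum.cong) auto
      finally show ?thesis using ab that by simp
    qed
    then show ?thesis by blast
  next
    case True
    \<comment> \<open>\<open>s0\<close> is a point of the last piece before \<open>m\<close>;
      inserting 0 covers the case that no earlier threshold is positive. Continuing the value at
      \<open>s0\<close> beyond \<open>m\<close> removes the jump there.\<close>
    define s0 where "s0 = Max (insert 0 D)"
    have s0: "0 \<le> s0" "s0 < m" "\<And>d. d \<in> D \<Longrightarrow> d \<le> s0"
      using insert.hyps True by (auto simp: s0_def)
    define \<psi> where "\<psi> t = (if t < m then \<phi> t else \<phi> s0)" for t
    have low: "\<phi> t = \<phi> s0" if "t \<in> {0..<1}" "t < m" "\<forall>d\<in>D. d \<le> t" for t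
      using that s0 True by (intro insert.prems) auto
    have "\<psi> s = \<psi> t" if "s \<in> {0..<1}" "t \<in> {0..<1}" "\<forall>d\<in>D. d \<le> s \<longleftrightarrow> d \<le> t" for s t
    proof -
      have above: "\<forall>d\<in>D. d \<le> u" if "m \<le> u" for u using that insert.hyps by force
      show ?thesis
        using that insert.prems[OF that(1,2)] low[OF that(1)] low[OF that(2)] above[of s] above[of t]
        by (auto simp: \<psi>_def)
    qed
    from insert.IH[of \<psi>, OF this] obtain b a
      where ab: "\<forall>t\<in>{0..<1}. \<psi> t = b + (\<Sum>d\<in>D. a d * indicator {d..} t)" by blast
    let ?a = "a(m := \<phi> m - \<phi> s0)"
    have "\<phi> t = b + (\<Sum>d\<in>insert m D. ?a d * indicator {d..} t)" if t: "t \<in> {0..<1}" for t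
    proof -
      have "(\<Sum>d\<in>insert m D. ?a d * indicator {d..} t)
          = (\<phi> m - \<phi> s0) * indicator {m..} t + (\<Sum>d\<in>D. ?a d * indicator {d..} t)"
        using insert.hyps by (subst sum.insert) auto
      also have "(\<Sum>d\<in>D. ?a d * indicator {d..} t) = (\<Sum>d\<in>D. a d * indicator {d..} t)"
        using insert.hyps by (intro sum.cong) auto
      finally have "b + (\<Sum>d\<in>insert m D. ?a d * indicator {d..} t) = \<psi> t + (\<phi> m - \<phi> s0) * indicator {m..} t"
        using ab t by simp
      also have "\<dots> = \<phi> t"
      proof (cases "t < m")
        case False
        then have "\<phi> t = \<phi> m" using t True insert.hyps by (intro insert.prems) force+
        then show ?thesis using False by (simp add: \<psi>_def)
      qed (simp add: \<psi>_def)
      finally show ?thesis by simp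
    qed
    then show ?thesis by blast
  qed
qed

text \<open>Intervals whose length is a multiple of the rotation angle have bounded discrepancy, because
  their indicator is a coboundary up to a constant. No case distinction on the rationality of the
  slope is therefore needed.\<close>

lemma floor_increment_sum:
  fixes u lam :: real and j N :: nat
  shows "\<bar>(\<Sum>k<N. real_of_int \<lfloor>u + real k * lam\<rfloor> - of_int \<lfloor>u + real k * lam - real j * lam\<rfloor>) - real N * (real j * lam)\<bar> \<le> real j"
proof (induction j)
  case (Suc j)
  define F where "F k = real_of_int \<lfloor>u + real k * lam - real (Suc j) * lam\<rfloor>" for k
  have F: "real_of_int \<lfloor>u + real k * lam - real j * lam\<rfloor> = F (Suc k)" for k
    by (simp add: F_def algebra_simps)
  have "(\<Sum>k<N. real_of_int \<lfloor>u + real k * lam\<rfloor> - F k)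
      = (\<Sum>k<N. real_of_int \<lfloor>u + real k * lam\<rfloor> - F (Suc k)) + (\<Sum>k<N. F (Suc k) - F k)"
    by (simp add: sum.distrib[symmetric])
  \<comment> \<open>One more multiple of the angle adds a sum that telescopes in time. It compares
    floors of two numbers \<open>real N * lam\<close> apart, so the error grows by at most 1 for
    each step of \<open>j\<close>.\<close>
  also have "(\<Sum>k<N. F (Suc k) - F k) = F N - F 0" by (rule sum_lessThan_telescope)
  finally have eq: "(\<Sum>k<N. real_of_int \<lfloor>u + real k * lam\<rfloor> - F k)
      = (\<Sum>k<N. real_of_int \<lfloor>u + real k * lam\<rfloor> - F (Suc k)) + (F N - F 0)" .
  have "\<bar>F N - F 0 - real N * lam\<bar> \<le> 1"
    unfolding F_def by (auto simp: algebra_simps abs_le_iff; linarith)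
  moreover have "real N * (real (Suc j) * lam) = real N * (real j * lam) + real N * lam"
    by (simp add: algebra_simps)
  ultimately show ?case
    using Suc.IH eq unfolding F F_def[symmetric] by (auto simp: abs_le_iff)
qed simp

text \<open>Comparing the fractional parts of \<open>v\<close> and \<open>w\<close> decides whether
  \<open>\<lfloor>v - w\<rfloor>\<close> picks up a carry, so the indicator is an affine function of
  the floor increment \<open>\<lfloor>v\<rfloor> - \<lfloor>v - w\<rfloor>\<close>.\<close>

lemma rotation_threshold_discrepancy:
  fixes u lam :: real and j N :: nat
  shows "\<bar>(\<Sum>k<N. indicat_real {frac (real j * lam)..} (frac (u + real k * lam))) - real N * (1 - frac (real j * lam))\<bar> \<le> real j"
proof -
  let ?w = "real j * lam"
  have ind: "indicat_real {frac ?w..} (frac v) = (1 + of_int \<lfloor>?w\<rfloor>) - (of_int \<lfloor>v\<rfloor> - of_int \<lfloor>v - ?w\<rfloor>)" for v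
  proof (cases "frac ?w \<le> frac v")
    case True
    then have "\<lfloor>v - ?w\<rfloor> = \<lfloor>v\<rfloor> - \<lfloor>?w\<rfloor>" unfolding frac_def by linarith
    then show ?thesis using True by simp
  next
    case False
    then have "\<lfloor>v - ?w\<rfloor> = \<lfloor>v\<rfloor> - \<lfloor>?w\<rfloor> - 1" unfolding frac_def by linarith
    then show ?thesis using False by simp
  qed
  have "(\<Sum>k<N. indicat_real {frac ?w..} (frac (u + real k * lam)))
     = real N * (1 + of_int \<lfloor>?w\<rfloor>) - (\<Sum>k<N. real_of_int \<lfloor>u + real k * lam\<rfloor> - of_int \<lfloor>u + real k * lam - ?w\<rfloor>)"
    unfolding ind by (simp add: sum_subtractf)
  moreover have "real N * (1 - frac ?w) = real N * (1 + of_int \<lfloor>?w\<rfloor>) - real N * ?w"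
    by (simp add: frac_def algebra_simps)
  ultimately show ?thesis using floor_increment_sum[where u = u and lam = lam and j = j and N = N] by linarith
qed

text \<open>The bound is the sum of \<open>\<bar>a d\<bar> * real (j d)\<close> over the thresholds.
  It involves neither \<open>u\<close> nor \<open>N\<close>, and this is the source of the
  uniformity in the offset of the segment.\<close>

lemma rotation_step_average:
  fixes \<phi> :: "real \<Rightarrow> real"
  assumes D: "finite D" "\<And>d. d \<in> D \<Longrightarrow> \<exists>j::nat. d = frac (real j * lam)"
    and \<phi>: "\<And>s t. s \<in> {0..<1} \<Longrightarrow> t \<in> {0..<1} \<Longrightarrow> (\<forall>d\<in>D. d \<le> s \<longleftrightarrow> d \<le> t) \<Longrightarrow> \<phi> s = \<phi> t"
  shows "set_integrable lborel {0..<1} \<phi>"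
    and "\<exists>C. \<forall>u N. \<bar>(\<Sum>k<N. \<phi> (frac (u + real k * lam))) - real N * (LBINT t:{0..<1}. \<phi> t)\<bar> \<le> C"
proof -
  obtain b a where ab: "\<forall>t\<in>{0..<1}. \<phi> t = b + (\<Sum>d\<in>D. a d * indicator {d..} t)"
    using threshold_representation[of D \<phi>, OF D(1) \<phi>] by blast
  obtain j :: "real \<Rightarrow> nat" where j: "\<And>d. d \<in> D \<Longrightarrow> d = frac (real (j d) * lam)" using D(2) by metis
  have D01: "0 \<le> d \<and> d < 1" if "d \<in> D" for d
    by (subst (1 2) j[OF that]) (simp add: frac_lt_1)
  have eq: "(\<lambda>t. indicator {0..<1} t *\<^sub>R \<phi> t)
      = (\<lambda>t. b * indicator {0..<1} t + (\<Sum>d\<in>D. a d * indicator {d..<1} t))"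
  proof
    fix t :: real
    have "indicator {0..<1} t * (\<Sum>d\<in>D. a d * indicator {d..} t) = (\<Sum>d\<in>D. a d * indicator {d..<1} t)"
      unfolding sum_distrib_left using D01 by (intro sum.cong refl) (force simp: indicator_def)
    moreover have "indicator {0..<1} t * \<phi> t = indicator {0..<1} t * (b + (\<Sum>d\<in>D. a d * indicator {d..} t))"
      using ab by (auto simp: indicator_def)
    ultimately show "indicator {0..<1} t *\<^sub>R \<phi> t = b * indicator {0..<1} t + (\<Sum>d\<in>D. a d * indicator {d..<1} t)"
      by (simp add: algebra_simps)
  qed
  have int: "integrable lborel (\<lambda>t. \<alpha> * indicat_real {d..<1} t)" for \<alpha> d :: real
    by (cases "d \<le> 1") auto
  show "set_integrable lborel {0..<1} \<phi>"
    unfolding set_integrable_def eq by (intro Bochner_Integration.integrable_add Bochner_Integration.integrable_sum int)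
  have val: "(LBINT t:{0..<1}. \<phi> t) = b + (\<Sum>d\<in>D. a d * (1 - d))"
  proof -
    have "(\<integral>t. (\<Sum>d\<in>D. a d * indicat_real {d..<1} t) \<partial>lborel) = (\<Sum>d\<in>D. \<integral>t. a d * indicat_real {d..<1} t \<partial>lborel)"
      by (rule Bochner_Integration.integral_sum) (rule int)
    also have "\<dots> = (\<Sum>d\<in>D. a d * (1 - d))"
    proof (intro sum.cong refl)
      fix d assume "d \<in> D"
      then have "d \<le> 1" using D01 by force
      then show "(\<integral>t. a d * indicat_real {d..<1} t \<partial>lborel) = a d * (1 - d)" by simp
    qed
    finally have "(\<integral>t. (\<Sum>d\<in>D. a d * indicat_real {d..<1} t) \<partial>lborel) = (\<Sum>d\<in>D. a d * (1 - d))" .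
    moreover have "(\<integral>t. b * indicat_real {0..<1::real} t \<partial>lborel) = b" by simp
    ultimately show ?thesis
      unfolding set_lebesgue_integral_def eq
      by (subst Bochner_Integration.integral_add[OF int Bochner_Integration.integrable_sum[OF int]]) simp
  qed
  have "\<bar>(\<Sum>k<N. \<phi> (frac (u + real k * lam))) - real N * (LBINT t:{0..<1}. \<phi> t)\<bar> \<le> (\<Sum>d\<in>D. \<bar>a d\<bar> * real (j d))" for u N
  proof -
    let ?t = "\<lambda>k. frac (u + real k * lam)"
    have "(\<Sum>k<N. \<phi> (?t k)) = (\<Sum>k<N. b + (\<Sum>d\<in>D. a d * indicator {d..} (?t k)))"
      using ab by (intro sum.cong) (auto simp: frac_lt_1)
    also have "\<dots> = real N * b + (\<Sum>d\<in>D. a d * (\<Sum>k<N. indicator {d..} (?t k)))"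
      by (simp add: sum.distrib sum_distrib_left sum.swap[of _ D])
    finally have "(\<Sum>k<N. \<phi> (?t k)) - real N * (LBINT t:{0..<1}. \<phi> t)
        = (\<Sum>d\<in>D. a d * ((\<Sum>k<N. indicator {d..} (?t k)) - real N * (1 - d)))"
      by (simp add: val algebra_simps sum_distrib_left sum_subtractf sum.distrib)
    also have "\<bar>\<dots>\<bar> \<le> (\<Sum>d\<in>D. \<bar>a d * ((\<Sum>k<N. indicator {d..} (?t k)) - real N * (1 - d))\<bar>)"
      by (rule sum_abs)
    also have "\<dots> \<le> (\<Sum>d\<in>D. \<bar>a d\<bar> * real (j d))"
    proof (rule sum_mono)
      fix d assume "d \<in> D"
      then have "\<bar>(\<Sum>k<N. indicat_real {d..} (?t k)) - real N * (1 - d)\<bar> \<le> real (j d)"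
        using rotation_threshold_discrepancy[where u = u and lam = lam and j = "j d" and N = N] j by simp
      then show "\<bar>a d * ((\<Sum>k<N. indicator {d..} (?t k)) - real N * (1 - d))\<bar> \<le> \<bar>a d\<bar> * real (j d)"
        unfolding abs_mult by (intro mult_left_mono) auto
    qed
    finally show ?thesis .
  qed
  then show "\<exists>C. \<forall>u N. \<bar>(\<Sum>k<N. \<phi> (frac (u + real k * lam))) - real N * (LBINT t:{0..<1}. \<phi> t)\<bar> \<le> C"
    by blast
qed

text \<open>In column \<open>- j\<close> the height of the line with offset \<open>r\<close> in
  \<open>{0..<1}\<close> is \<open>- \<lfloor>real j * lam\<rfloor>\<close>, lowered by one exactly
  when \<open>r\<close> is below \<open>frac (real j * lam)\<close>. These fractional parts are thus
  the only thresholds of a truncated past.\<close>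

lemma Lline_threshold_cong:
  assumes st: "s \<in> {0..<1}" "t \<in> {0..<1}"
    and eq: "\<forall>d\<in>(\<lambda>j. frac (real j * lam)) ` {1..K}. d \<le> s \<longleftrightarrow> d \<le> t"
  shows "Lline lam s {- int K..-1} = Lline lam t {- int K..-1}"
proof -
  have "\<lfloor>lam * of_int z + s\<rfloor> = \<lfloor>lam * of_int z + t\<rfloor>" if z: "z \<in> {- int K..-1}" for z
  proof -
    obtain j :: nat where j: "z = - int j" "j \<in> {1..K}"
      using z by (intro that[of "nat (- z)"]) auto
    have fl: "\<lfloor>lam * of_int z + r\<rfloor> = - \<lfloor>real j * lam\<rfloor> - (if frac (real j * lam) \<le> r then 0 else 1)"
      if "r \<in> {0..<1}" for r
      using that unfolding frac_def j floor_eq_iff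
      by (auto simp: algebra_simps; linarith)
    show ?thesis unfolding fl[OF st(1)] fl[OF st(2)] using eq j(2) by auto
  qed
  then show ?thesis unfolding Lline_eq_image by (intro image_cong) auto
qed

section \<open>Mixing\<close>

text \<open>Second moment method. Each row of the covariance matrix has at most
  \<open>2 * R + 1\<close> entries near the diagonal, each bounded crudely by
  \<open>2 * C\<^sup>2\<close>; all others are at most \<open>e\<close>. Neither stationarity of the
  sequence nor a common mean is assumed.\<close>

lemma (in prob_space) weakly_correlated_average:
  fixes Z :: "nat \<Rightarrow> 'a \<Rightarrow> real"
  assumes Z_meas [measurable]: "\<And>k. Z k \<in> borel_measurable M" and Z_bd: "\<And>k x. \<bar>Z k x\<bar> \<le> C"
    and cov: "\<And>j k. j < N \<Longrightarrow> k < N \<Longrightarrow> int R < \<bar>int j - int k\<bar> \<Longrightarrow>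
      \<bar>expectation (\<lambda>x. Z j x * Z k x) - expectation (Z j) * expectation (Z k)\<bar> \<le> e"
    and N: "N > 0" and e: "e \<ge> 0"
  shows "expectation (\<lambda>x. \<bar>(\<Sum>k<N. Z k x) / real N - (\<Sum>k<N. expectation (Z k)) / real N\<bar>)
    \<le> sqrt (e + (2 * real R + 1) * (2 * C\<^sup>2) / real N)"
proof -
  define Y where "Y k x = Z k x - expectation (Z k)" for k x
  have [measurable]: "Y k \<in> borel_measurable M" for k unfolding Y_def[abs_def] by measurable
  have C0: "C \<ge> 0" using Z_bd[of 0 undefined] by linarith
  have iZ: "integrable M (Z k)" for k using Z_bd by (intro integrable_const_bound[of _ C]) auto
  have EZ: "\<bar>expectation (Z k)\<bar> \<le> C" for k
  proof -
    have "\<bar>expectation (Z k)\<bar> \<le> expectation (\<lambda>x. \<bar>Z k x\<bar>)" by (rule integral_abs_bound)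
    also have "\<dots> \<le> expectation (\<lambda>x. C)" using Z_bd iZ by (intro integral_mono) auto
    finally show ?thesis using prob_space by simp
  qed
  have iZZ: "integrable M (\<lambda>x. Z j x * Z k x)" for j k
    by (rule integrable_bounded_mult[where C = C and D = C]) (use Z_bd in auto)
  have ZZ: "\<bar>expectation (\<lambda>x. Z j x * Z k x)\<bar> \<le> C\<^sup>2" for j k
  proof -
    have "\<bar>expectation (\<lambda>x. Z j x * Z k x)\<bar> \<le> expectation (\<lambda>x. \<bar>Z j x * Z k x\<bar>)" by (rule integral_abs_bound)
    also have "\<dots> \<le> expectation (\<lambda>x. C\<^sup>2)"
    proof (intro integral_mono integrable_abs iZZ)
      show "\<bar>Z j x * Z k x\<bar> \<le> C\<^sup>2" for x
        unfolding abs_mult power2_eq_square using Z_bd C0 by (intro mult_mono) auto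
    qed simp
    finally show ?thesis using prob_space by simp
  qed
  have YY_eq: "Y j x * Y k x = Z j x * Z k x - expectation (Z k) * Z j x - expectation (Z j) * Z k x
      + expectation (Z j) * expectation (Z k)" for j k x
    by (simp add: Y_def algebra_simps)
  have iYY: "integrable M (\<lambda>x. Y j x * Y k x)" for j k
    unfolding YY_eq using iZ iZZ by auto
  have YY: "expectation (\<lambda>x. Y j x * Y k x) = expectation (\<lambda>x. Z j x * Z k x) - expectation (Z j) * expectation (Z k)" for j k
    unfolding YY_eq using iZ iZZ prob_space by simp
  have YY_bd: "expectation (\<lambda>x. Y j x * Y k x) \<le> e + (if \<bar>int j - int k\<bar> \<le> int R then 2 * C\<^sup>2 else 0)"
    if "j < N" "k < N" for j k
  proof (cases "\<bar>int j - int k\<bar> \<le> int R")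
    case True
    have "\<bar>expectation (Z j) * expectation (Z k)\<bar> \<le> C * C"
      unfolding abs_mult using EZ C0 by (intro mult_mono) auto
    then show ?thesis using True ZZ[of j k] e unfolding YY power2_eq_square by (simp add: abs_le_iff)
  next
    case False
    then have "\<bar>expectation (\<lambda>x. Y j x * Y k x)\<bar> \<le> e" using cov[OF that] unfolding YY by linarith
    then show ?thesis using False by simp
  qed
  have sq: "(\<Sum>k<N. Y k x)\<^sup>2 = (\<Sum>j<N. \<Sum>k<N. Y j x * Y k x)" for x
    by (simp add: power2_eq_square sum_product)
  have "expectation (\<lambda>x. (\<Sum>k<N. Y k x)\<^sup>2) = (\<Sum>j<N. \<Sum>k<N. expectation (\<lambda>x. Y j x * Y k x))"
    unfolding sq using iYY by (simp add: Bochner_Integration.integral_sum Bochner_Integration.integrable_sum)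
  also have "\<dots> \<le> (\<Sum>j<N. \<Sum>k<N. e + (if \<bar>int j - int k\<bar> \<le> int R then 2 * C\<^sup>2 else 0))"
    by (intro sum_mono YY_bd) auto
  also have "\<dots> \<le> (\<Sum>j<N. real N * e + (2 * real R + 1) * (2 * C\<^sup>2))"
  proof (rule sum_mono)
    fix j
    have "card {k \<in> {..<N}. \<bar>int j - int k\<bar> \<le> int R} \<le> card {j - R..j + R}"
      by (intro card_mono) auto
    also have "\<dots> \<le> 2 * R + 1" by simp
    finally have "real (card {k \<in> {..<N}. \<bar>int j - int k\<bar> \<le> int R}) \<le> 2 * real R + 1" by linarith
    then have "real (card {k \<in> {..<N}. \<bar>int j - int k\<bar> \<le> int R}) * (2 * C\<^sup>2) \<le> (2 * real R + 1) * (2 * C\<^sup>2)"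
      by (intro mult_right_mono) auto
    moreover have "(\<Sum>k<N. if \<bar>int j - int k\<bar> \<le> int R then 2 * C\<^sup>2 else 0)
        = real (card {k \<in> {..<N}. \<bar>int j - int k\<bar> \<le> int R}) * (2 * C\<^sup>2)"
      by (subst sum.inter_filter[symmetric]) auto
    ultimately show "(\<Sum>k<N. e + (if \<bar>int j - int k\<bar> \<le> int R then 2 * C\<^sup>2 else 0)) \<le> real N * e + (2 * real R + 1) * (2 * C\<^sup>2)"
      by (simp add: sum.distrib)
  qed
  finally have main: "expectation (\<lambda>x. (\<Sum>k<N. Y k x)\<^sup>2) \<le> real N * (real N * e + (2 * real R + 1) * (2 * C\<^sup>2))"
    by simp
  have "expectation (\<lambda>x. \<bar>(\<Sum>k<N. Y k x) / real N\<bar>) \<le> sqrt (expectation (\<lambda>x. ((\<Sum>k<N. Y k x) / real N)\<^sup>2))"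
    unfolding power_divide sq using iYY
    by (intro L1_le_L2[unfolded power_divide, of "\<lambda>x. (\<Sum>k<N. Y k x) / real N", unfolded power_divide sq])
      auto
  also have "\<dots> \<le> sqrt (e + (2 * real R + 1) * (2 * C\<^sup>2) / real N)"
  proof (rule real_sqrt_le_mono)
    have "expectation (\<lambda>x. ((\<Sum>k<N. Y k x) / real N)\<^sup>2) = expectation (\<lambda>x. (\<Sum>k<N. Y k x)\<^sup>2) / (real N)\<^sup>2"
      by (simp add: power_divide)
    also have "\<dots> \<le> (real N * (real N * e + (2 * real R + 1) * (2 * C\<^sup>2))) / (real N)\<^sup>2"
      by (intro divide_right_mono main) auto
    also have "\<dots> = e + (2 * real R + 1) * (2 * C\<^sup>2) / real N"
      using N by (simp add: power2_eq_square field_simps)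
    finally show "expectation (\<lambda>x. ((\<Sum>k<N. Y k x) / real N)\<^sup>2) \<le> e + (2 * real R + 1) * (2 * C\<^sup>2) / real N" .
  qed
  also have "expectation (\<lambda>x. \<bar>(\<Sum>k<N. Y k x) / real N\<bar>)
      = expectation (\<lambda>x. \<bar>(\<Sum>k<N. Z k x) / real N - (\<Sum>k<N. expectation (Z k)) / real N\<bar>)"
    by (simp add: Y_def sum_subtractf diff_divide_distrib)
  finally show ?thesis .
qed

section \<open>Decay of covariances from the strong 0-1 law\<close>

context strong_random_field
begin

lemma cond_exp_FF_empty:
  fixes X :: "'a config \<Rightarrow> real"
  assumes "integrable P X"
  shows "real_cond_exp P (FF {}) X \<omega> = (\<integral>\<eta>. X \<eta> \<partial>P)"
proof -
  interpret F: sigma_finite_subalgebra P "FF {}" by (rule subalgebra_sigma_finite[OF subalgebra_FF])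
  have const: "real_cond_exp P (FF {}) X \<eta> = real_cond_exp P (FF {}) X \<omega>" for \<eta>
    by (rule borel_measurable_FF_cong[OF borel_measurable_cond_exp]) simp
  have "(\<integral>\<eta>. X \<eta> \<partial>P) = (\<integral>\<eta>. real_cond_exp P (FF {}) X \<eta> \<partial>P)"
    by (rule F.real_cond_exp_int(2)[OF assms, symmetric])
  also have "\<dots> = (\<integral>\<eta>. real_cond_exp P (FF {}) X \<omega> \<partial>P)" by (rule Bochner_Integration.integral_cong[OF refl const])
  finally show ?thesis using prob_space by simp
qed

text \<open>Since \<open>g\<close> is measurable for \<open>FF J\<close>, the factor
  \<open>X\<close> may be replaced by its conditional expectation. The covariance becomes the
  integral of \<open>g\<close> against the deviation of that conditional expectation from the
  mean.\<close>

lemma cov_le_cond_exp_dist: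
  fixes X g :: "'a config \<Rightarrow> real"
  assumes X [measurable]: "X \<in> borel_measurable P" "\<And>\<omega>. \<bar>X \<omega>\<bar> \<le> C"
    and g: "g \<in> borel_measurable (FF J)" "\<And>\<omega>. \<bar>g \<omega>\<bar> \<le> D"
  shows "\<bar>(\<integral>\<omega>. X \<omega> * g \<omega> \<partial>P) - (\<integral>\<omega>. X \<omega> \<partial>P) * (\<integral>\<omega>. g \<omega> \<partial>P)\<bar>
    \<le> D * (\<integral>\<omega>. \<bar>real_cond_exp P (FF J) X \<omega> - (\<integral>\<omega>. X \<omega> \<partial>P)\<bar> \<partial>P)"
proof -
  interpret F: sigma_finite_subalgebra P "FF J" by (rule subalgebra_sigma_finite[OF subalgebra_FF])
  let ?W = "real_cond_exp P (FF J) X" and ?m = "\<integral>\<omega>. X \<omega> \<partial>P"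
  have [measurable]: "g \<in> borel_measurable P" by (rule measurable_FF_P[OF g(1)])
  have W: "AE \<omega> in P. \<bar>?W \<omega>\<bar> \<le> C" by (rule cond_exp_bounded[OF subalgebra_FF X])
  have gb: "AE \<omega> in P. \<bar>g \<omega>\<bar> \<le> D" using g by simp
  have igX: "integrable P (\<lambda>\<omega>. g \<omega> * X \<omega>)"
    by (rule integrable_bounded_mult[OF _ _ gb, where D = C]) (use X in auto)
  have igW: "integrable P (\<lambda>\<omega>. g \<omega> * ?W \<omega>)" by (rule integrable_bounded_mult[OF _ _ gb W]) auto
  have ig: "integrable P g" using gb by (intro integrable_const_bound[of _ D]) auto
  have iW: "integrable P ?W" by (rule integrable_cond_exp[OF subalgebra_FF X])
  have "(\<integral>\<omega>. X \<omega> * g \<omega> \<partial>P) = (\<integral>\<omega>. g \<omega> * ?W \<omega> \<partial>P)"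
    using F.real_cond_exp_intg(2)[OF igX g(1)] by (simp add: mult.commute)
  then have "(\<integral>\<omega>. X \<omega> * g \<omega> \<partial>P) - ?m * (\<integral>\<omega>. g \<omega> \<partial>P) = (\<integral>\<omega>. g \<omega> * ?W \<omega> - ?m * g \<omega> \<partial>P)"
    using igW ig by simp
  also have "\<dots> = (\<integral>\<omega>. g \<omega> * (?W \<omega> - ?m) \<partial>P)"
    by (intro Bochner_Integration.integral_cong) (auto simp: algebra_simps)
  also have "\<bar>\<dots>\<bar> \<le> (\<integral>\<omega>. \<bar>g \<omega> * (?W \<omega> - ?m)\<bar> \<partial>P)" by (rule integral_abs_bound)
  also have "\<dots> \<le> (\<integral>\<omega>. D * \<bar>?W \<omega> - ?m\<bar> \<partial>P)"
  proof (rule integral_mono)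
    have "integrable P (\<lambda>\<omega>. g \<omega> * ?W \<omega> - ?m * g \<omega>)" using igW ig by simp
    moreover have "(\<lambda>\<omega>. g \<omega> * (?W \<omega> - ?m)) = (\<lambda>\<omega>. g \<omega> * ?W \<omega> - ?m * g \<omega>)" by (simp add: algebra_simps)
    ultimately show "integrable P (\<lambda>\<omega>. \<bar>g \<omega> * (?W \<omega> - ?m)\<bar>)" by simp
    show "\<bar>g \<omega> * (?W \<omega> - ?m)\<bar> \<le> D * \<bar>?W \<omega> - ?m\<bar>" for \<omega>
      unfolding abs_mult using g(2)[of \<omega>] by (rule mult_right_mono) simp
  qed (use iW in auto)
  finally show ?thesis by simp
qed

end

context bounded_random_field
begin

lemma ln_c_neg: "ln c < 0"
  using c_pos c_less_1 by simp

text \<open>The conditional expectation of a local function given the complement of a growing box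
  tends in L1 to its mean, and a pattern shifted far away is measurable for that complement.\<close>

lemma cond_info_mixing:
  assumes e: "e > 0"
  shows "\<exists>R::nat. \<forall>I J v. I \<subseteq> box K - {(0,0)} \<longrightarrow> J \<subseteq> box K - {(0,0)} \<longrightarrow> int R < \<bar>fst v\<bar> \<longrightarrow>
    \<bar>(\<integral>\<omega>. cond_info I \<omega> * cond_info J (shift v \<omega>) \<partial>P) - (\<integral>\<omega>. cond_info I \<omega> \<partial>P) * (\<integral>\<omega>. cond_info J \<omega> \<partial>P)\<bar> \<le> e"
proof -
  let ?B = "box K - {(0,0)}" and ?L = "- ln c"
  have fin: "finite I" "(0,0) \<notin> I" if "I \<subseteq> ?B" for I using that finite_subset[of I "box K"] by auto
  have bd: "\<bar>cond_info I \<omega>\<bar> \<le> ?L" if "I \<subseteq> ?B" for I \<omega> using cond_info_bounds[OF fin[OF that]] by auto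
  have "(\<lambda>m. \<integral>\<omega>. \<bar>real_cond_exp P (FF (- box m)) (cond_info I) \<omega> - (\<integral>\<omega>. cond_info I \<omega> \<partial>P)\<bar> \<partial>P) \<longlonglongrightarrow> 0"
    if "I \<subseteq> ?B" for I
    using cond_exp_tail_limit[OF measurable_cond_info bd[OF that], of "{}"] fin[OF that]
    by (simp add: cond_exp_FF_empty[OF integrable_cond_info])
  \<comment> \<open>The box has finitely many subsets, so one \<open>m\<close> serves all patterns
    \<open>I\<close>; dividing by \<open>?L\<close> compensates the bound on the second
    factor.\<close>
  then have "eventually (\<lambda>m. \<forall>I\<in>Pow ?B. (\<integral>\<omega>. \<bar>real_cond_exp P (FF (- box m)) (cond_info I) \<omega> - (\<integral>\<omega>. cond_info I \<omega> \<partial>P)\<bar> \<partial>P) < e / ?L) sequentially"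
    using e ln_c_neg by (intro eventually_ball_finite ballI order_tendstoD(2)) (auto simp: divide_pos_neg)
  from eventually_happens'[OF sequentially_bot this] obtain m where m: "\<forall>I\<in>Pow ?B.
      (\<integral>\<omega>. \<bar>real_cond_exp P (FF (- box m)) (cond_info I) \<omega> - (\<integral>\<omega>. cond_info I \<omega> \<partial>P)\<bar> \<partial>P) < e / ?L" ..
  show ?thesis
  proof (intro exI[of _ "m + K"] allI impI)
    fix I J and v :: site
    assume I: "I \<subseteq> ?B" and J: "J \<subseteq> ?B" and v: "int (m + K) < \<bar>fst v\<bar>"
    \<comment> \<open>A site of the pattern has first coordinate at most \<open>K\<close> in
      absolute value, so a horizontal shift by more than \<open>m + K\<close> moves it out of
      \<open>box m\<close>.\<close>
    have sub: "(\<lambda>u. u + v) ` insert (0,0) J \<subseteq> - box m"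
    proof
      fix w assume "w \<in> (\<lambda>u. u + v) ` insert (0,0) J"
      then obtain u where u: "u \<in> insert (0,0) J" "w = u + v" by blast
      have "u = (0,0) \<or> u \<in> box K" using u(1) J by blast
      then have "\<bar>fst u\<bar> \<le> int K" by (auto simp: box_def)
      then have "int m < \<bar>fst w\<bar>" using v u(2) by simp
      then show "w \<in> - box m" by (auto simp: box_def)
    qed
    have "(\<lambda>\<omega>. cond_info J (shift v \<omega>)) \<in> borel_measurable (FF ((\<lambda>u. u + v) ` insert (0,0) J))"
      by (rule measurable_compose[OF measurable_shift_FF measurable_cond_info_FF[OF fin[OF J]]])
    then have g: "(\<lambda>\<omega>. cond_info J (shift v \<omega>)) \<in> borel_measurable (FF (- box m))"
      by (rule measurable_from_subalg[OF subalgebra_FF_mono[OF sub]])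
    have "\<bar>(\<integral>\<omega>. cond_info I \<omega> * cond_info J (shift v \<omega>) \<partial>P) - (\<integral>\<omega>. cond_info I \<omega> \<partial>P) * (\<integral>\<omega>. cond_info J (shift v \<omega>) \<partial>P)\<bar>
      \<le> ?L * (\<integral>\<omega>. \<bar>real_cond_exp P (FF (- box m)) (cond_info I) \<omega> - (\<integral>\<omega>. cond_info I \<omega> \<partial>P)\<bar> \<partial>P)"
      by (rule cov_le_cond_exp_dist[OF measurable_cond_info bd[OF I] g bd[OF J]])
    also have "\<dots> \<le> ?L * (e / ?L)"
      using bspec[OF m PowI[OF I]] ln_c_neg by (intro mult_left_mono) auto
    also have "\<dots> = e" using ln_c_neg by simp
    finally show "\<bar>(\<integral>\<omega>. cond_info I \<omega> * cond_info J (shift v \<omega>) \<partial>P) - (\<integral>\<omega>. cond_info I \<omega> \<partial>P) * (\<integral>\<omega>. cond_info J \<omega> \<partial>P)\<bar> \<le> e"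
      using integral_shift[OF measurable_cond_info, of J v] by simp
  qed
qed

section \<open>Information along a line\<close>

text \<open>Allowing every \<open>J\<close> between the truncated and the full past covers two uses
  at once: the longer finite pasts in the chain rule and the infinite past in
  \<open>h_slope\<close>.\<close>

lemma cond_info_uniform:
  assumes e: "e > 0"
  shows "\<exists>K. \<forall>t\<in>{0..1}. \<forall>J. Lline lam t {- int K..-1} \<subseteq> J \<longrightarrow> J \<subseteq> Lline lam t {z. z \<le> -1} \<longrightarrow>
    (\<integral>\<omega>. \<bar>cond_info J \<omega> - cond_info (Lline lam t {- int K..-1}) \<omega>\<bar> \<partial>P) \<le> e"
proof -
  \<comment> \<open>Chosen so that \<open>CARD('a) / c * sqrt e'\<close> equals
    \<open>e\<close>.\<close>
  define e' where "e' = (e * c / CARD('a))\<^sup>2"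
  have "e' > 0" using e c_pos by (simp add: e'_def)
  then obtain K where K: "\<forall>t\<in>{0..1}. law_sqnorm (Lline lam t {z. z \<le> -1}) - law_sqnorm (Lline lam t {- int K..-1}) \<le> e'"
    using law_sqnorm_uniform by blast
  have "(\<integral>\<omega>. \<bar>cond_info J \<omega> - cond_info (Lline lam t {- int K..-1}) \<omega>\<bar> \<partial>P) \<le> e"
    if t: "t \<in> {0..1}" and J: "Lline lam t {- int K..-1} \<subseteq> J" "J \<subseteq> Lline lam t {z. z \<le> -1}" for t J
  proof -
    have "(0,0) \<notin> J" using J(2) origin_notin_Lline by blast
    then have "(\<integral>\<omega>. \<bar>cond_info J \<omega> - cond_info (Lline lam t {- int K..-1}) \<omega>\<bar> \<partial>P)
      \<le> CARD('a) / c * sqrt (law_sqnorm J - law_sqnorm (Lline lam t {- int K..-1}))"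
      by (rule cond_info_L1_dist[OF J(1)])
    also have "\<dots> \<le> CARD('a) / c * sqrt e'"
      using bspec[OF K t] law_sqnorm_mono[OF J(2)] c_pos by (intro mult_left_mono real_sqrt_le_mono) auto
    also have "\<dots> = e" using e c_pos by (simp add: e'_def)
    finally show ?thesis .
  qed
  then show ?thesis by blast
qed

section \<open>Entropies as functions of the offset\<close>

definition line_entropy :: "real \<Rightarrow> nat \<Rightarrow> real \<Rightarrow> real" where
  "line_entropy lam K t = (\<integral>\<omega>. cond_info (Lline lam t {- int K..-1}) \<omega> \<partial>P)"

definition past_entropy :: "real \<Rightarrow> real \<Rightarrow> real" where
  "past_entropy lam t = (\<integral>\<omega>. cond_info (Lline lam t {z. z \<le> -1}) \<omega> \<partial>P)"

lemma h_slope_eq: "h_slope lam P = (LBINT t:{0..1}. past_entropy lam t)"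
  unfolding h_slope_def past_def past_entropy_def
  by (simp add: integral_cond_info origin_notin_Lline)

lemma line_entropy_rotation:
  shows "set_integrable lborel {0..<1} (line_entropy lam K)"
    and "\<exists>C. \<forall>u N. \<bar>(\<Sum>k<N. line_entropy lam K (frac (u + real k * lam)))
      - real N * (LBINT t:{0..<1}. line_entropy lam K t)\<bar> \<le> C"
proof -
  let ?D = "(\<lambda>j. frac (real j * lam)) ` {1..K}"
  have D: "finite ?D" "\<And>d. d \<in> ?D \<Longrightarrow> \<exists>j::nat. d = frac (real j * lam)" by auto
  have \<phi>: "line_entropy lam K s = line_entropy lam K t"
    if "s \<in> {0..<1}" "t \<in> {0..<1}" "\<forall>d\<in>?D. d \<le> s \<longleftrightarrow> d \<le> t" for s t
    unfolding line_entropy_def using Lline_threshold_cong[OF that] by simp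
  show "set_integrable lborel {0..<1} (line_entropy lam K)"
    by (rule rotation_step_average(1)[of ?D lam "line_entropy lam K", OF D \<phi>])
  show "\<exists>C. \<forall>u N. \<bar>(\<Sum>k<N. line_entropy lam K (frac (u + real k * lam)))
      - real N * (LBINT t:{0..<1}. line_entropy lam K t)\<bar> \<le> C"
    by (rule rotation_step_average(2)[of ?D lam "line_entropy lam K", OF D \<phi>])
qed

lemma past_entropy_bound: "\<bar>past_entropy lam t\<bar> \<le> - ln c"
proof -
  let ?J = "Lline lam t {z. z \<le> -1}"
  have J: "(0,0) \<notin> ?J" by (rule origin_notin_Lline) simp
  have "\<bar>past_entropy lam t\<bar> \<le> (\<integral>\<omega>. \<bar>cond_info ?J \<omega>\<bar> \<partial>P)"
    unfolding past_entropy_def by (rule integral_abs_bound)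
  also have "\<dots> \<le> (\<integral>\<omega>. - ln c \<partial>P)"
    by (rule integral_mono_AE) (use cond_info_AE_bound[OF J] integrable_cond_info[OF J] in auto)
  finally show ?thesis using prob_space by simp
qed

lemma line_entropy_approx:
  assumes "t \<in> {0..1}"
    and "\<forall>J. Lline lam t {- int K..-1} \<subseteq> J \<longrightarrow> J \<subseteq> Lline lam t {z. z \<le> -1} \<longrightarrow>
      (\<integral>\<omega>. \<bar>cond_info J \<omega> - cond_info (Lline lam t {- int K..-1}) \<omega>\<bar> \<partial>P) \<le> e"
  shows "\<bar>past_entropy lam t - line_entropy lam K t\<bar> \<le> e"
proof -
  let ?J = "Lline lam t {z. z \<le> -1}" and ?I = "Lline lam t {- int K..-1}"
  have J: "(0,0) \<notin> ?J" "(0,0) \<notin> ?I" by (auto intro!: origin_notin_Lline)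
  have "past_entropy lam t - line_entropy lam K t = (\<integral>\<omega>. cond_info ?J \<omega> - cond_info ?I \<omega> \<partial>P)"
    using J integrable_cond_info by (simp add: past_entropy_def line_entropy_def)
  also have "\<bar>\<dots>\<bar> \<le> (\<integral>\<omega>. \<bar>cond_info ?J \<omega> - cond_info ?I \<omega>\<bar> \<partial>P)" by (rule integral_abs_bound)
  also have "\<dots> \<le> e" by (rule assms(2)[rule_format]) (auto intro!: Lline_mono)
  finally show ?thesis .
qed

text \<open>Measurability in the offset is not visible from the definition; it is inherited from the
  step functions \<open>line_entropy\<close>, which converge uniformly as the truncation depth
  grows.\<close>

lemma set_integrable_past_entropy: "set_integrable lborel {0..<1} (past_entropy lam)"
proof -
  have "\<forall>i::nat. \<exists>K. \<forall>t\<in>{0..1}. \<bar>past_entropy lam t - line_entropy lam K t\<bar> \<le> inverse (real (Suc i))"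
  proof
    fix i :: nat
    obtain K where "\<forall>t\<in>{0..1}. \<forall>J. Lline lam t {- int K..-1} \<subseteq> J \<longrightarrow> J \<subseteq> Lline lam t {z. z \<le> -1} \<longrightarrow>
      (\<integral>\<omega>. \<bar>cond_info J \<omega> - cond_info (Lline lam t {- int K..-1}) \<omega>\<bar> \<partial>P) \<le> inverse (real (Suc i))"
      using cond_info_uniform[of "inverse (real (Suc i))" lam] by auto
    then have "\<forall>t\<in>{0..1}. \<bar>past_entropy lam t - line_entropy lam K t\<bar> \<le> inverse (real (Suc i))"
      by (intro ballI line_entropy_approx) auto
    then show "\<exists>K. \<forall>t\<in>{0..1}. \<bar>past_entropy lam t - line_entropy lam K t\<bar> \<le> inverse (real (Suc i))" ..
  qed
  then obtain K where K: "\<And>i t. t \<in> {0..1} \<Longrightarrow> \<bar>past_entropy lam t - line_entropy lam (K i) t\<bar> \<le> inverse (real (Suc i))"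
    by metis
  have meas: "(\<lambda>t. indicator {0..<1} t *\<^sub>R past_entropy lam t) \<in> borel_measurable lborel"
  proof (rule borel_measurable_LIMSEQ_real)
    show "(\<lambda>t. indicator {0..<1} t *\<^sub>R line_entropy lam (K i) t) \<in> borel_measurable lborel" for i
      using line_entropy_rotation(1)[of lam "K i"] by (auto simp: set_integrable_def)
    fix t :: real
    show "(\<lambda>i. indicator {0..<1} t *\<^sub>R line_entropy lam (K i) t) \<longlonglongrightarrow> indicator {0..<1} t *\<^sub>R past_entropy lam t"
    proof (cases "t \<in> {0..<1}")
      case True
      have "(\<lambda>i. line_entropy lam (K i) t - past_entropy lam t) \<longlonglongrightarrow> 0"
        by (rule Lim_null_comparison[OF always_eventually LIMSEQ_inverse_real_of_nat])
          (use K[of t] True in \<open>auto simp: abs_minus_commute\<close>)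
      then show ?thesis using True by (simp add: LIM_zero_cancel)
    qed simp
  qed
  show ?thesis unfolding set_integrable_def
  proof (rule Bochner_Integration.integrable_bound[OF _ meas])
    show "integrable lborel (\<lambda>t. - ln c * indicat_real {0..<1::real} t)" by simp
    show "AE t in lborel. norm (indicat_real {0..<1} t *\<^sub>R past_entropy lam t) \<le> norm (- ln c * indicat_real {0..<1} t)"
      using past_entropy_bound[of lam] ln_c_neg by (auto simp: indicator_def)
  qed
qed

lemma h_slope_approx:
  assumes "\<And>t. t \<in> {0..<1} \<Longrightarrow> \<bar>past_entropy lam t - line_entropy lam K t\<bar> \<le> e"
  shows "\<bar>h_slope lam P - (LBINT t:{0..<1}. line_entropy lam K t)\<bar> \<le> e"
proof -
  have h: "h_slope lam P = (LBINT t:{0..<1}. past_entropy lam t)"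
    unfolding h_slope_eq set_lebesgue_integral_def
  proof (rule integral_cong_AE)
    have m: "(\<lambda>t. indicator {0..<1} t *\<^sub>R past_entropy lam t) \<in> borel_measurable lborel"
      using set_integrable_past_entropy by (auto simp: set_integrable_def)
    then show "(\<lambda>t. indicator {0..<1} t *\<^sub>R past_entropy lam t) \<in> borel_measurable lborel" .
    \<comment> \<open>The step functions are controlled on \<open>{0..<1}\<close>, whereas
      \<open>h_slope\<close> integrates over \<open>{0..1}\<close>; the endpoint is a null set, and
      its value is added by hand to obtain measurability.\<close>
    have "(\<lambda>t. indicator {0..<1} t *\<^sub>R past_entropy lam t + indicator {1} t * past_entropy lam 1) \<in> borel_measurable lborel"
      using m by (intro borel_measurable_add) auto
    moreover have "indicator {0..<1} t *\<^sub>R past_entropy lam t + indicator {1} t * past_entropy lam 1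
        = indicator {0..1} t *\<^sub>R past_entropy lam t" for t
      by (auto simp: indicator_def)
    ultimately show "(\<lambda>t. indicator {0..1} t *\<^sub>R past_entropy lam t) \<in> borel_measurable lborel" by simp
    have "AE t in lborel. t \<noteq> (1::real)" by (rule AE_lborel_singleton)
    then show "AE t in lborel. indicat_real {0..1} t *\<^sub>R past_entropy lam t = indicat_real {0..<1} t *\<^sub>R past_entropy lam t"
      by eventually_elim (auto simp: indicator_def)
  qed
  have "h_slope lam P - (LBINT t:{0..<1}. line_entropy lam K t) = (LBINT t:{0..<1}. past_entropy lam t - line_entropy lam K t)"
    unfolding h using set_integrable_past_entropy line_entropy_rotation(1) by (simp add: set_integral_diff)
  also have "\<bar>\<dots>\<bar> \<le> (\<integral>t. \<bar>indicat_real {0..<1} t *\<^sub>R (past_entropy lam t - line_entropy lam K t)\<bar> \<partial>lborel)"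
    unfolding set_lebesgue_integral_def by (rule integral_abs_bound)
  also have "\<dots> \<le> (\<integral>t. e * indicat_real {0..<1::real} t \<partial>lborel)"
  proof (rule integral_mono)
    show "integrable lborel (\<lambda>t. \<bar>indicat_real {0..<1} t *\<^sub>R (past_entropy lam t - line_entropy lam K t)\<bar>)"
      using set_integral_diff(1)[OF set_integrable_past_entropy[of lam] line_entropy_rotation(1)[of lam K]]
      unfolding set_integrable_def by (rule integrable_abs)
    show "integrable lborel (\<lambda>t. e * indicat_real {0..<1::real} t)" by simp
  qed (use assms in \<open>auto simp: indicator_def\<close>)
  also have "\<dots> = e" by simp
  finally show ?thesis .
qed

section \<open>Chain rule and averaging along a segment\<close>

text \<open>The rightmost site is translated to the origin, and the earlier ones become a past of
  depth \<open>k\<close>. The integer part of the height is absorbed by the vertical shift, and its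
  fractional part is the offset of that past.\<close>

lemma info_line_chain_rule:
  fixes a lam :: real and z0 :: int
  shows "info P (Lline lam a {z0..<z0 + int N}) \<omega>
    = (\<Sum>k<N. cond_info (Lline lam (frac (lam * of_int z0 + a + real k * lam)) {- int k..-1})
        (shift (z0 + int k, \<lfloor>lam * of_int z0 + a + real k * lam\<rfloor>) \<omega>))"
proof (induction N)
  case 0
  then show ?case by (simp add: Lline_def)
next
  case (Suc N)
  let ?v = "lam * of_int z0 + a + real N * lam"
  let ?s = "(z0 + int N, \<lfloor>?v\<rfloor>)" and ?J = "Lline lam (frac ?v) {- int N..-1}"
  have J: "finite ?J" "(0,0) \<notin> ?J" by (auto intro!: origin_notin_Lline)
  have shift_J: "(\<lambda>u. u + ?s) ` ?J = Lline lam a {z0..<z0 + int N}"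
  proof -
    have "(\<lambda>u. u + ?s) ` ?J = (\<lambda>z. (z, \<lfloor>lam * of_int z + a\<rfloor>)) ` (\<lambda>z. z + (z0 + int N)) ` {- int N..-1}"
      unfolding Lline_eq_image image_image
    proof (rule image_cong[OF refl])
      fix z :: int
      have "lam * of_int (z + (z0 + int N)) + a = (lam * of_int z + frac ?v) + of_int \<lfloor>?v\<rfloor>"
        by (simp add: frac_def algebra_simps)
      then have "\<lfloor>lam * of_int (z + (z0 + int N)) + a\<rfloor> = \<lfloor>lam * of_int z + frac ?v\<rfloor> + \<lfloor>?v\<rfloor>"
        by (simp only: floor_add_int)
      then show "(z, \<lfloor>lam * of_int z + frac ?v\<rfloor>) + ?s = (z + (z0 + int N), \<lfloor>lam * of_int (z + (z0 + int N)) + a\<rfloor>)"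
        by simp
    qed
    also have "(\<lambda>z. z + (z0 + int N)) ` {- int N..-1} = {z0..<z0 + int N}"
      by (auto simp: image_iff intro!: bexI[of _ "_ - (z0 + int N)"])
    finally show ?thesis by (simp add: Lline_eq_image)
  qed
  have "{z0..<z0 + int (Suc N)} = insert (z0 + int N) {z0..<z0 + int N}" by auto
  moreover have "\<lfloor>lam * of_int (z0 + int N) + a\<rfloor> = \<lfloor>?v\<rfloor>" by (simp add: algebra_simps)
  ultimately have "Lline lam a {z0..<z0 + int (Suc N)} = insert ?s (Lline lam a {z0..<z0 + int N})"
    unfolding Lline_eq_image by simp
  also have "\<dots> = (\<lambda>u. u + ?s) ` insert (0,0) ?J" unfolding image_insert shift_J by simp
  finally have "info P (Lline lam a {z0..<z0 + int (Suc N)}) \<omega> = info P (insert (0,0) ?J) (shift ?s \<omega>)"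
    using info_translate[of "insert (0,0) ?J" ?s \<omega>] J by simp
  also have "\<dots> = cond_info ?J (shift ?s \<omega>) + info P ?J (shift ?s \<omega>)"
    by (simp add: cond_info_finite[OF J])
  also have "info P ?J (shift ?s \<omega>) = info P (Lline lam a {z0..<z0 + int N}) \<omega>"
    using info_translate[OF J(1), of ?s \<omega>] unfolding shift_J by simp
  finally show ?case using Suc.IH by simp
qed

text \<open>A slope in the unit interval keeps the height between \<open>- K\<close> and 0 on these
  columns. The truncated pasts of all offsets are thus among the finitely many patterns covered by
  the mixing estimate.\<close>

lemma Lline_subset_box:
  assumes "0 \<le> lam" "lam \<le> 1" "t \<in> {0..<1}"
  shows "Lline lam t {- int K..-1} \<subseteq> box K - {(0,0)}"
proof -
  have "\<lfloor>lam * of_int z + t\<rfloor> \<in> {- int K..int K}" if z: "z \<in> {- int K..-1}" for z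
  proof -
    have "lam * of_int z \<ge> 1 * of_int z" using z assms by (intro mult_right_mono_neg) auto
    moreover have "lam * of_int z \<le> 0" using z assms by (intro mult_nonneg_nonpos) auto
    moreover have "real_of_int z \<ge> - real K" using z by simp
    ultimately have "- real K \<le> lam * of_int z + t" "lam * of_int z + t < 1" using assms by auto
    then have "- int K \<le> \<lfloor>lam * of_int z + t\<rfloor>" "\<lfloor>lam * of_int z + t\<rfloor> \<le> 0" by linarith+
    then show ?thesis unfolding atLeastAtMost_iff by linarith
  qed
  then show ?thesis by (auto simp: Lline_def box_def)
qed

text \<open>The depth \<open>K\<close>, the range \<open>R\<close> and the discrepancy constant
  \<open>C\<close> are fixed before \<open>z0\<close> and \<open>a\<close>, hence so is
  \<open>N0\<close>. The total \<open>6 * e\<close> is made of \<open>2 * e\<close> for truncation,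
  \<open>2 * e\<close> for fluctuations, \<open>e\<close> for discrepancy and \<open>e\<close> for
  passing from truncated entropies to \<open>h_slope\<close>.\<close>

lemma info_line_L1_limit:
  assumes lam: "0 \<le> lam" "lam \<le> 1" and e: "e > 0"
  shows "\<exists>N0. \<forall>N\<ge>N0. \<forall>z0 a.
    (\<integral>\<omega>. \<bar>info P (Lline lam a {z0..<z0 + int N}) \<omega> / real N - h_slope lam P\<bar> \<partial>P) \<le> 6 * e"
proof -
  define L where "L = - ln c"
  have L0: "L > 0" using ln_c_neg by (simp add: L_def)
  obtain K where K: "\<forall>t\<in>{0..1}. \<forall>J. Lline lam t {- int K..-1} \<subseteq> J \<longrightarrow> J \<subseteq> Lline lam t {z. z \<le> -1} \<longrightarrow>
      (\<integral>\<omega>. \<bar>cond_info J \<omega> - cond_info (Lline lam t {- int K..-1}) \<omega>\<bar> \<partial>P) \<le> e"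
    using cond_info_uniform[OF e] by blast
  define IK where "IK = (LBINT t:{0..<1}. line_entropy lam K t)"
  obtain C where C: "\<And>u N. \<bar>(\<Sum>k<N. line_entropy lam K (frac (u + real k * lam))) - real N * IK\<bar> \<le> C"
    using line_entropy_rotation(2)[of lam K] unfolding IK_def by blast
  have IK: "\<bar>IK - h_slope lam P\<bar> \<le> e"
    unfolding IK_def abs_minus_commute[of _ "h_slope lam P"]
    by (intro h_slope_approx line_entropy_approx) (use K in auto)
  \<comment> \<open>Covariances are bounded by \<open>e\<^sup>2\<close> because a square root is
    taken when passing from L2 to L1.\<close>
  have e2: "e\<^sup>2 > 0" using e by simp
  from cond_info_mixing[OF e2, of K]
  obtain R where R: "\<forall>I J v. I \<subseteq> box K - {(0,0)} \<longrightarrow> J \<subseteq> box K - {(0,0)} \<longrightarrow> int R < \<bar>fst v\<bar> \<longrightarrow>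
    \<bar>(\<integral>\<omega>. cond_info I \<omega> * cond_info J (shift v \<omega>) \<partial>P) - (\<integral>\<omega>. cond_info I \<omega> \<partial>P) * (\<integral>\<omega>. cond_info J \<omega> \<partial>P)\<bar> \<le> e\<^sup>2" ..
  define B where "B = (2 * real R + 1) * (2 * L\<^sup>2)"
  \<comment> \<open>The three quotients make negligible, in this order, the initial terms with a
    short past, the covariances near the diagonal, and the discrepancy.\<close>
  define N0 where "N0 = Suc (nat \<lceil>max (real K * L / e) (max (B / e\<^sup>2) (C / e))\<rceil>)"
  have "(\<integral>\<omega>. \<bar>info P (Lline lam a {z0..<z0 + int N}) \<omega> / real N - h_slope lam P\<bar> \<partial>P) \<le> 6 * e"
    if N: "N \<ge> N0" for N z0 a
  proof -
    have N_pos: "N > 0" using N by (simp add: N0_def)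
    have "max (real K * L / e) (max (B / e\<^sup>2) (C / e)) \<le> real N" using N unfolding N0_def by linarith
    then have large: "real K * L / real N \<le> e" "B / real N \<le> e\<^sup>2" "C / real N \<le> e"
      using N_pos e by (auto simp: field_simps)
    define u where "u = lam * of_int z0 + a"
    define t where "t k = frac (u + real k * lam)" for k :: nat
    define s where "s k = (z0 + int k, \<lfloor>u + real k * lam\<rfloor>)" for k :: nat
    define I where "I k = Lline lam (t k) {- int k..-1}" for k
    define J where "J k = Lline lam (t k) {- int K..-1}" for k
    define X where "X k \<omega> = cond_info (I k) (shift (s k) \<omega>)" for k \<omega>
    define Y where "Y k \<omega> = cond_info (J k) (shift (s k) \<omega>)" for k \<omega>
    have t01: "t k \<in> {0..<1}" for k by (simp add: t_def frac_lt_1)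
    have I: "finite (I k)" "(0,0) \<notin> I k" and J: "finite (J k)" "(0,0) \<notin> J k" for k
      by (auto simp: I_def J_def intro!: origin_notin_Lline)
    have [measurable]: "X k \<in> borel_measurable P" "Y k \<in> borel_measurable P" for k
      unfolding X_def[abs_def] Y_def[abs_def] by measurable
    have X_bd: "0 \<le> X k \<omega>" "X k \<omega> \<le> L" and Y_bd: "0 \<le> Y k \<omega>" "Y k \<omega> \<le> L" for k \<omega>
      using cond_info_bounds[OF I] cond_info_bounds[OF J] by (auto simp: X_def Y_def L_def)
    have X_int: "integrable P (X k)" and Y_int: "integrable P (Y k)" for k
      using X_bd Y_bd by (auto intro!: integrable_const_bound[of _ L])
    have EY: "(\<integral>\<omega>. Y k \<omega> \<partial>P) = line_entropy lam K (t k)" for k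
      unfolding Y_def line_entropy_def J_def by (rule integral_shift) measurable
    \<comment> \<open>The first \<open>K\<close> terms have a past shorter than the truncation
      depth, so only the trivial bound \<open>L\<close> applies; both informations lie between 0 and
      \<open>L\<close>.\<close>
    have XY: "(\<integral>\<omega>. \<bar>X k \<omega> - Y k \<omega>\<bar> \<partial>P) \<le> e + (if k < K then L else 0)" for k
    proof (cases "k < K")
      case True
      have "(\<integral>\<omega>. \<bar>X k \<omega> - Y k \<omega>\<bar> \<partial>P) \<le> (\<integral>\<omega>. L \<partial>P)"
      proof (rule integral_mono)
        show "\<bar>X k \<omega> - Y k \<omega>\<bar> \<le> L" for \<omega> using X_bd[of k \<omega>] Y_bd[of k \<omega>] by linarith
      qed (use X_int Y_int in auto)
      then show ?thesis using True e prob_space by simp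
    next
      case False
      have "(\<integral>\<omega>. \<bar>X k \<omega> - Y k \<omega>\<bar> \<partial>P) = (\<integral>\<omega>. \<bar>cond_info (I k) \<omega> - cond_info (J k) \<omega>\<bar> \<partial>P)"
        unfolding X_def Y_def
        by (rule integral_shift[of "\<lambda>\<omega>. \<bar>cond_info (I k) \<omega> - cond_info (J k) \<omega>\<bar>"]) measurable
      also have "\<dots> \<le> e"
        unfolding J_def by (rule K[rule_format]) (use t01[of k] False in \<open>auto simp: I_def intro!: Lline_mono\<close>)
      finally show ?thesis using False by simp
    qed
    have t1: "(\<integral>\<omega>. \<bar>(\<Sum>k<N. X k \<omega>) / real N - (\<Sum>k<N. Y k \<omega>) / real N\<bar> \<partial>P) \<le> 2 * e"
    proof -
      have "(\<integral>\<omega>. \<bar>(\<Sum>k<N. X k \<omega>) / real N - (\<Sum>k<N. Y k \<omega>) / real N\<bar> \<partial>P) \<le> (\<integral>\<omega>. (\<Sum>k<N. \<bar>X k \<omega> - Y k \<omega>\<bar>) / real N \<partial>P)"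
      proof (rule integral_mono)
        show "\<bar>(\<Sum>k<N. X k \<omega>) / real N - (\<Sum>k<N. Y k \<omega>) / real N\<bar> \<le> (\<Sum>k<N. \<bar>X k \<omega> - Y k \<omega>\<bar>) / real N" for \<omega>
          using N_pos by (simp add: diff_divide_distrib[symmetric] sum_subtractf[symmetric] abs_divide divide_right_mono sum_abs)
      qed (use X_int Y_int in auto)
      also have "\<dots> = (\<Sum>k<N. \<integral>\<omega>. \<bar>X k \<omega> - Y k \<omega>\<bar> \<partial>P) / real N"
        using X_int Y_int by (simp add: Bochner_Integration.integral_sum)
      also have "\<dots> \<le> (\<Sum>k<N. e + (if k < K then L else 0)) / real N"
        by (intro divide_right_mono sum_mono XY) auto
      also have "(\<Sum>k<N. e + (if k < K then L else 0)) \<le> real N * e + real K * L"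
      proof -
        have "(\<Sum>k<N. if k < K then L else 0) = real (card {k \<in> {..<N}. k < K}) * L"
          by (subst sum.inter_filter[symmetric]) auto
        also have "\<dots> \<le> real K * L"
          using L0 card_mono[of "{..<K}" "{k \<in> {..<N}. k < K}"] by (intro mult_right_mono) auto
        finally show ?thesis by (simp add: sum.distrib)
      qed
      then have "(\<Sum>k<N. e + (if k < K then L else 0)) / real N \<le> (real N * e + real K * L) / real N"
        by (rule divide_right_mono) simp
      also have "(real N * e + real K * L) / real N = e + real K * L / real N"
        using N_pos by (simp add: field_simps)
      finally show ?thesis using large(1) by simp
    qed
    have t2: "(\<integral>\<omega>. \<bar>(\<Sum>k<N. Y k \<omega>) / real N - (\<Sum>k<N. \<integral>\<omega>. Y k \<omega> \<partial>P) / real N\<bar> \<partial>P) \<le> 2 * e"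
    proof -
      have "(\<integral>\<omega>. \<bar>(\<Sum>k<N. Y k \<omega>) / real N - (\<Sum>k<N. \<integral>\<omega>. Y k \<omega> \<partial>P) / real N\<bar> \<partial>P)
        \<le> sqrt (e\<^sup>2 + (2 * real R + 1) * (2 * L\<^sup>2) / real N)"
      proof (rule weakly_correlated_average)
        show "\<bar>Y k \<omega>\<bar> \<le> L" for k \<omega> using Y_bd[of k \<omega>] by simp
        fix j k :: nat assume "int R < \<bar>int j - int k\<bar>"
        then have v: "int R < \<bar>fst (s k - s j)\<bar>" by (simp add: s_def)
        \<comment> \<open>Stationarity moves the base point \<open>s j\<close> to the origin. What
          remains is the relative shift \<open>s k - s j\<close>, whose horizontal part is
          \<open>k - j\<close> whatever the slope and the offset.\<close>
        have "(\<integral>\<omega>. Y j \<omega> * Y k \<omega> \<partial>P) = (\<integral>\<omega>. cond_info (J j) (shift (s j) \<omega>) * cond_info (J k) (shift (s k - s j) (shift (s j) \<omega>)) \<partial>P)"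
          by (simp add: Y_def shift_shift)
        also have "\<dots> = (\<integral>\<omega>. cond_info (J j) \<omega> * cond_info (J k) (shift (s k - s j) \<omega>) \<partial>P)"
          by (rule integral_shift[of "\<lambda>\<omega>. cond_info (J j) \<omega> * cond_info (J k) (shift (s k - s j) \<omega>)"]) measurable
        finally show "\<bar>(\<integral>\<omega>. Y j \<omega> * Y k \<omega> \<partial>P) - (\<integral>\<omega>. Y j \<omega> \<partial>P) * (\<integral>\<omega>. Y k \<omega> \<partial>P)\<bar> \<le> e\<^sup>2"
          using R[rule_format, OF _ _ v, of "J j" "J k"] Lline_subset_box[OF lam t01]
          by (simp add: EY line_entropy_def J_def)
      qed (use N_pos in auto)
      also have "\<dots> \<le> sqrt ((2 * e)\<^sup>2)"
      proof (rule real_sqrt_le_mono)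
        have "(2 * e)\<^sup>2 = 4 * e\<^sup>2" by (simp add: power_mult_distrib)
        then show "e\<^sup>2 + (2 * real R + 1) * (2 * L\<^sup>2) / real N \<le> (2 * e)\<^sup>2"
          using large(2) e2 unfolding B_def by linarith
      qed
      also have "\<dots> = 2 * e" unfolding real_sqrt_abs using e by simp
      finally show ?thesis .
    qed
    have t3: "\<bar>(\<Sum>k<N. \<integral>\<omega>. Y k \<omega> \<partial>P) / real N - IK\<bar> \<le> e"
    proof -
      have "\<bar>(\<Sum>k<N. \<integral>\<omega>. Y k \<omega> \<partial>P) / real N - IK\<bar> = \<bar>(\<Sum>k<N. \<integral>\<omega>. Y k \<omega> \<partial>P) - real N * IK\<bar> / real N"
        using N_pos by (simp add: field_simps)
      also have "\<dots> \<le> C / real N"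
        using C[of u N] by (intro divide_right_mono) (auto simp: EY t_def)
      finally show ?thesis using large(3) by simp
    qed
    let ?SX = "\<lambda>\<omega>. (\<Sum>k<N. X k \<omega>) / real N" and ?SY = "\<lambda>\<omega>. (\<Sum>k<N. Y k \<omega>) / real N"
      and ?m = "(\<Sum>k<N. \<integral>\<omega>. Y k \<omega> \<partial>P) / real N"
    have iX: "integrable P ?SX" and iY: "integrable P ?SY" using X_int Y_int by auto
    have "info P (Lline lam a {z0..<z0 + int N}) \<omega> = (\<Sum>k<N. X k \<omega>)" for \<omega>
      unfolding info_line_chain_rule X_def I_def t_def s_def u_def ..
    then have "(\<integral>\<omega>. \<bar>info P (Lline lam a {z0..<z0 + int N}) \<omega> / real N - h_slope lam P\<bar> \<partial>P)
        = (\<integral>\<omega>. \<bar>?SX \<omega> - h_slope lam P\<bar> \<partial>P)" by simp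
    also have "\<dots> \<le> (\<integral>\<omega>. \<bar>?SX \<omega> - ?SY \<omega>\<bar> + \<bar>?SY \<omega> - ?m\<bar> + (\<bar>?m - IK\<bar> + \<bar>IK - h_slope lam P\<bar>) \<partial>P)"
      using iX iY by (intro integral_mono) auto
    also have "\<dots> = (\<integral>\<omega>. \<bar>?SX \<omega> - ?SY \<omega>\<bar> \<partial>P) + (\<integral>\<omega>. \<bar>?SY \<omega> - ?m\<bar> \<partial>P) + (\<bar>?m - IK\<bar> + \<bar>IK - h_slope lam P\<bar>)"
      using iX iY prob_space by simp
    also have "\<dots> \<le> 6 * e" using t1 t2 t3 IK by linarith
    finally show ?thesis .
  qed
  then show ?thesis by blast
qed

end

section \<open>Application to the blown-up segments\<close>

text \<open>The columns form a run of consecutive integers, written by first element and length to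
  match the averaging result; \<open>nat\<close> clips the length to 0 when the interval contains no
  integer.\<close>

lemma Ln_eq_Lline:
  "Ln lam x x' n b = Lline lam (real n * b) {\<lceil>real n * x\<rceil>..<\<lceil>real n * x\<rceil> + int (nat (\<lfloor>real n * x'\<rfloor> + 1 - \<lceil>real n * x\<rceil>))}"
proof -
  have "real n * x \<le> of_int z \<and> of_int z \<le> real n * x' \<longleftrightarrow>
      z \<in> {\<lceil>real n * x\<rceil>..<\<lceil>real n * x\<rceil> + int (nat (\<lfloor>real n * x'\<rfloor> + 1 - \<lceil>real n * x\<rceil>))}" for z
    by (auto simp: ceiling_le_iff le_floor_iff; linarith)
  then show ?thesis unfolding Ln_def Lline_def by auto
qed

lemma card_Lline: "finite U \<Longrightarrow> card (Lline lam a U) = card U"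
  unfolding Lline_eq_image by (rule card_image) (auto simp: inj_on_def)

theorem theorem4p1:
  fixes P :: "('a::finite) config measure"
    and lam x x' :: real
  assumes "prob_space P"
    and "sets P = sets config_space"
    and "stationary P"
    and "strong_01_law P"
    and "condition_B P"
    and "0 \<le> lam" and "lam \<le> 1"
    and "x < x'"
  shows "(\<lambda>n. SUP b. ereal (\<integral>\<omega>. \<bar>info P (Ln lam x x' n b) \<omega> / real (card (Ln lam x x' n b))
                                    - h_slope lam P\<bar> \<partial>P))
         \<longlonglongrightarrow> 0"
proof -
  obtain c0 where c0: "c0 > 0" "\<forall>y. \<forall>A \<in> sets (FF (UNIV - {(0,0)})).
      measure P A > 0 \<longrightarrow> measure P ({\<omega>. \<omega> (0,0) = y} \<inter> A) / measure P A > c0"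
    using assms(5) unfolding condition_B_def by blast
  interpret prob_space P by fact
  interpret bounded_random_field P c0
    by unfold_locales (use assms c0 in auto)
  define N where "N n = nat (\<lfloor>real n * x'\<rfloor> + 1 - \<lceil>real n * x\<rceil>)" for n :: nat
  define d where "d n b = (\<integral>\<omega>. \<bar>info P (Ln lam x x' n b) \<omega> / real (card (Ln lam x x' n b)) - h_slope lam P\<bar> \<partial>P)" for n b
  have card: "card (Ln lam x x' n b) = N n" for n b
    unfolding Ln_eq_Lline by (subst card_Lline) (auto simp: N_def)
  have N_lower: "real (N n) \<ge> real n * (x' - x) - 1" for n
    unfolding N_def by (simp add: algebra_simps; linarith)
  have "filterlim (\<lambda>n. real n * (x' - x) - 1) at_top sequentially"
    using \<open>x < x'\<close> by real_asymp
  then have "filterlim (\<lambda>n. real (N n)) at_top sequentially"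
    by (rule filterlim_at_top_mono) (use N_lower in auto)
  then have N_lim: "filterlim N at_top sequentially"
    by (simp add: filterlim_real_sequentially filterlim_sequentially_iff_filterlim_real)
  \<comment> \<open>The number of columns does not depend on \<open>b\<close>, which enters only
    through the offset \<open>real n * b\<close>. Since \<open>N0\<close> serves all offsets, one
    threshold for \<open>n\<close> serves all \<open>b\<close>, and the bound passes to the
    supremum.\<close>
  have small: "eventually (\<lambda>n. \<forall>b. d n b \<le> e) sequentially" if "e > 0" for e
  proof -
    obtain N0 where N0: "\<forall>N\<ge>N0. \<forall>z0 a.
        (\<integral>\<omega>. \<bar>info P (Lline lam a {z0..<z0 + int N}) \<omega> / real N - h_slope lam P\<bar> \<partial>P) \<le> 6 * (e / 6)"
      using info_line_L1_limit[OF assms(6,7), of "e / 6"] \<open>e > 0\<close> by auto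
    have "eventually (\<lambda>n. N0 \<le> N n) sequentially" using N_lim by (simp add: filterlim_at_top)
    then show ?thesis
    proof eventually_elim
      case (elim n)
      show ?case
      proof
        fix b
        show "d n b \<le> e"
          unfolding d_def card using N0[rule_format, OF elim, of "real n * b" "\<lceil>real n * x\<rceil>"]
          by (simp add: Ln_eq_Lline N_def)
      qed
    qed
  qed
  have "(\<lambda>n. SUP b. ereal (d n b)) \<longlonglongrightarrow> 0"
  proof (rule order_tendstoI)
    fix a :: ereal assume "a < 0"
    have "0 \<le> (SUP b. ereal (d n b))" for n
    proof -
      have "0 \<le> ereal (d n 0)" by (simp add: d_def)
      also have "\<dots> \<le> (SUP b. ereal (d n b))" by (rule SUP_upper) simp
      finally show ?thesis .
    qed
    then have "a < (SUP b. ereal (d n b))" for n by (rule less_le_trans[OF \<open>a < 0\<close>])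
    then show "eventually (\<lambda>n. a < (SUP b. ereal (d n b))) sequentially" by simp
  next
    fix a :: ereal assume "0 < a"
    then obtain e where e: "0 < ereal e" "ereal e < a" using ereal_dense2 by blast
    from e(1) have "e > 0" by simp
    from small[OF this] show "eventually (\<lambda>n. (SUP b. ereal (d n b)) < a) sequentially"
    proof eventually_elim
      case (elim n)
      then have "(SUP b. ereal (d n b)) \<le> ereal e" by (intro SUP_least) auto
      then show ?case using e(2) by (rule le_less_trans)
    qed
  qed
  then show ?thesis unfolding d_def .
qed

end
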